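(* Suppose that $F:\mathcal V\to\mathbb R\cup\{+\infty\}$ and $G:\mathcal U\to\mathbb R\cup\{+\infty\}$ are proper lower semicontinuous convex functions, and $H:\mathcal V\to\mathbb R$ is a differentiable convex function with locally Lipschitz continuous gradient, and that the problem $\min_{u\in\mathcal U}\max_{v\in\mathcal V}\Psi(u,v)$ has a saddle point. Then the sequence $(u^k,v^k)$ generated by the Primal-dual algorithm with backtracking linesearch converges to a saddle point $(\hat u,\hat v)$ of this problem, and $\big(\hat{\mathcal G}_{(\hat u,\hat v)}(u^k,v^k)\big)$ converges to $0$.
   Context: Setting. $\mathcal U,\mathcal V$ are finite-dimensional real Hilbert spaces, $K:\mathcal U\to\mathcal V$ is a nonzero linear operator with adjoint $K^*$ and operator norm $\|K\|$, and $$\Psi(u,v)=\langle Ku,v\rangle+G(u)-F(v)-H(v).$$ A saddle point is a pair $(\hat u,\hat v)\in\mathcal U\times\mathcal V$ with $\Psi(\hat u,v)\le\Psi(\hat u,\hat v)\le\Psi(u,\hat v)$ for all $(u,v)\in\mathcal U\times\mathcal V$; equivalently, $\hat u\in\operatorname{dom}G$, $\hat v\in\operatorname{dom}F$ and, for all $u,v$, $$\hat P_{(\hat u,\hat v)}(u):=G(u)-G(\hat u)+\langle K^*\hat v,u-\hat u\rangle\ge0,\qquad \hat D_{(\hat u,\hat v)}(v):=(F+H)(v)-(F+H)(\hat v)-\langle K\hat u,v-\hat v\rangle\ge0.$$ The primal-dual gap is $\hat{\mathcal G}_{(\hat u,\hat v)}(u,v)=\hat P_{(\hat u,\hat v)}(u)+\hat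 D_{(\hat u,\hat v)}(v)$. For a proper lsc convex $\phi$ and $\tau>0$, $\operatorname{prox}_{\tau\phi}(x)=\arg\min_y\{\phi(y)+\frac1{2\tau}\|y-x\|^2\}$. Primal-dual algorithm with backtracking linesearch. Choose $u^0\in\mathcal U$, $v^1\in\mathcal V$, $\beta>0$, $\delta_L\in(0,1)$, $\rho\in(0,1)$, $\tau_0>0$, $\gamma\in(0,1)$, $\delta_K\in(0,1)$ with $\delta_K+\delta_L<1$. Set $\theta_0=1$. For $k=1,2,\dots$: Step 1: $u^k=\operatorname{prox}_{\tau_{k-1}G}(u^{k-1}-\tau_{k-1}K^*v^k)$. Step 2: choose $\alpha_k\in[1,\sqrt{1+\gamma\theta_{k-1}}]$ and put $\tau_{k(0)}=\min\Big\{\frac{\sqrt{\delta_K}}{\sqrt\beta\,\|K\|},\ \tau_{k-1}\alpha_k\Big\}$. Then for $j=0,1,\dots$ set $$\theta_{k(j)}=\tau_{k(j)}\tau_{k-1}^{-1},\quad \overline u^{k(j)}=u^k+\theta_{k(j)}(u^k-u^{k-1}),\quad v^{k(j)+1}=\operatorname{prox}_{\beta\tau_{k(j)}F}\big(v^k+\beta\tau_{k(j)}[K\overline u^{k(j)}-\nabla H(v^k)]\big).$$ If $$\tau_{k(j)}\big(H(v^{k(j)+1})-H(v^k)-\langle\nabla H(v^k),v^{k(j)+1}-v^k\rangle\big)>\frac{\delta_L}{2\beta}\|v^{k(j)+1}-v^k\|^2,$$ set $\tau_{k(j+1)}=\rho\,\tau_{k(j)}$ and continue with $j+1$; otherwise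 set $\tau_k=\tau_{k(j)}$, $v^{k+1}=v^{k(j)+1}$, $\theta_k=\tau_k\tau_{k-1}^{-1}$ and leave the inner loop. *)

theory Defs
  imports "HOL-Analysis.Analysis"
begin

definition proper_fun :: "('a \<Rightarrow> ereal) \<Rightarrow> bool" where
  "proper_fun f \<longleftrightarrow> (\<forall>x. f x \<noteq> -\<infinity>) \<and> (\<exists>x. f x \<noteq> \<infinity>)"

definition lsc_fun :: "('a::topological_space \<Rightarrow> ereal) \<Rightarrow> bool" where
  "lsc_fun f \<longleftrightarrow> (\<forall>x. f x \<le> Liminf (at x) f)"

text \<open>Meant for functions that avoid \<open>-\<infinity>\<close>. The endpoint weights are harmless because
  \<open>0 * \<infinity> = 0\<close> in \<^typ>\<open>ereal\<close>.\<close>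
definition convex_fun :: "('a::real_vector \<Rightarrow> ereal) \<Rightarrow> bool" where
  "convex_fun f \<longleftrightarrow> (\<forall>x y. \<forall>s\<ge>0. \<forall>t\<ge>0. s + t = 1 \<longrightarrow>
     f (s *\<^sub>R x + t *\<^sub>R y) \<le> ereal s * f x + ereal t * f y)"

definition proper_lsc_convex :: "('a::real_normed_vector \<Rightarrow> ereal) \<Rightarrow> bool" where
  "proper_lsc_convex f \<longleftrightarrow> proper_fun f \<and> lsc_fun f \<and> convex_fun f"

text \<open>\<open>prox t \<phi>\<close> is the proximal map of \<open>t\<phi>\<close>; for \<open>t > 0\<close> and \<open>\<phi>\<close> proper, lsc and convex
  the minimiser exists and is unique.\<close>
definition prox :: "real \<Rightarrow> ('a::real_normed_vector \<Rightarrow> ereal) \<Rightarrow> 'a \<Rightarrow> 'a" where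
  "prox t \<phi> x = (ARG_MIN (\<lambda>y. \<phi> y + ereal (1 / (2 * t) * (norm (y - x))\<^sup>2)) y. True)"

definition Psi ::
  "('u::euclidean_space \<Rightarrow> 'v::euclidean_space) \<Rightarrow> ('u \<Rightarrow> ereal) \<Rightarrow> ('v \<Rightarrow> ereal) \<Rightarrow> ('v \<Rightarrow> real)
    \<Rightarrow> 'u \<Rightarrow> 'v \<Rightarrow> ereal" where
  "Psi K G F H u v = ereal (K u \<bullet> v) + G u - F v - ereal (H v)"

text \<open>If \<open>G u = F v = \<infinity>\<close>, the arithmetic of \<^typ>\<open>ereal\<close> gives \<open>Psi K G F H u v = \<infinity>\<close>. This
  convention does not affect the notion of saddle point, see \<open>saddle_point_iff\<close> below.\<close>
definition saddle_point ::
  "('u::euclidean_space \<Rightarrow> 'v::euclidean_space) \<Rightarrow> ('u \<Rightarrow> ereal) \<Rightarrow> ('v \<Rightarrow> ereal) \<Rightarrow> ('v \<Rightarrow> real)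
    \<Rightarrow> 'u \<Rightarrow> 'v \<Rightarrow> bool" where
  "saddle_point K G F H uh vh \<longleftrightarrow>
     (\<forall>u v. Psi K G F H uh v \<le> Psi K G F H uh vh \<and> Psi K G F H uh vh \<le> Psi K G F H u vh)"

definition primal_gap ::
  "('u::euclidean_space \<Rightarrow> 'v::euclidean_space) \<Rightarrow> ('u \<Rightarrow> ereal) \<Rightarrow> 'u \<Rightarrow> 'v \<Rightarrow> 'u \<Rightarrow> ereal" where
  "primal_gap K G uh vh u = G u - G uh + ereal (adjoint K vh \<bullet> (u - uh))"

definition dual_gap ::
  "('u::euclidean_space \<Rightarrow> 'v::euclidean_space) \<Rightarrow> ('v \<Rightarrow> ereal) \<Rightarrow> ('v \<Rightarrow> real)
    \<Rightarrow> 'u \<Rightarrow> 'v \<Rightarrow> 'v \<Rightarrow> ereal" where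
  "dual_gap K F H uh vh v =
     (F v + ereal (H v)) - (F vh + ereal (H vh)) - ereal (K uh \<bullet> (v - vh))"

definition primal_dual_gap ::
  "('u::euclidean_space \<Rightarrow> 'v::euclidean_space) \<Rightarrow> ('u \<Rightarrow> ereal) \<Rightarrow> ('v \<Rightarrow> ereal) \<Rightarrow> ('v \<Rightarrow> real)
    \<Rightarrow> 'u \<Rightarrow> 'v \<Rightarrow> 'u \<Rightarrow> 'v \<Rightarrow> ereal" where
  "primal_dual_gap K G F H uh vh u v = primal_gap K G uh vh u + dual_gap K F H uh vh v"

lemma saddle_point_iff:
  fixes K :: "'u::euclidean_space \<Rightarrow> 'v::euclidean_space"
  assumes K: "linear K" and G: "proper_fun G" and F: "proper_fun F"
  shows "saddle_point K G F H uh vh \<longleftrightarrow>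
    G uh \<noteq> \<infinity> \<and> F vh \<noteq> \<infinity> \<and> (\<forall>u. 0 \<le> primal_gap K G uh vh u) \<and> (\<forall>v. 0 \<le> dual_gap K F H uh vh v)"
proof -
  obtain u0 where u0: "G u0 \<noteq> \<infinity>" "G u0 \<noteq> -\<infinity>" using G by (auto simp: proper_fun_def)
  obtain v0 where v0: "F v0 \<noteq> \<infinity>" "F v0 \<noteq> -\<infinity>" using F by (auto simp: proper_fun_def)
  have nm: "G x \<noteq> -\<infinity>" "F y \<noteq> -\<infinity>" for x y using G F by (auto simp: proper_fun_def)
  have adj: "adjoint K vh \<bullet> (u - uh) = K u \<bullet> vh - K uh \<bullet> vh" for u
    by (simp add: adjoint_clauses[OF K] linear_diff[OF K] inner_diff_left inner_diff_right inner_commute)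
  have dom: "G uh \<noteq> \<infinity> \<and> F vh \<noteq> \<infinity>" if S: "saddle_point K G F H uh vh"
  proof -
    have Gu: "G uh \<noteq> \<infinity>"
    proof
      assume a: "G uh = \<infinity>"
      have "Psi K G F H uh v0 \<le> Psi K G F H u0 vh"
        using S order_trans[of "Psi K G F H uh v0" "Psi K G F H uh vh"]
        by (simp add: saddle_point_def)
      then show False using a u0 v0 nm(2)[of vh]
        by (cases "G u0"; cases "F v0"; cases "F vh") (auto simp: Psi_def)
    qed
    have "F vh \<noteq> \<infinity>"
    proof
      assume a: "F vh = \<infinity>"
      have "Psi K G F H uh v0 \<le> Psi K G F H uh vh" using S by (simp add: saddle_point_def)
      then show False using a v0 Gu nm(1)[of uh]
        by (cases "G uh"; cases "F v0") (auto simp: Psi_def)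
    qed
    with Gu show ?thesis by simp
  qed
  have P: "Psi K G F H uh vh \<le> Psi K G F H u vh \<longleftrightarrow> 0 \<le> primal_gap K G uh vh u"
    if "G uh \<noteq> \<infinity>" "F vh \<noteq> \<infinity>" for u
    using that nm(1)[of uh] nm(2)[of vh] nm(1)[of u] nm(2)[of vh]
    by (cases "G uh"; cases "F vh"; cases "G u") (auto simp: Psi_def primal_gap_def adj)
  have D: "Psi K G F H uh v \<le> Psi K G F H uh vh \<longleftrightarrow> 0 \<le> dual_gap K F H uh vh v"
    if "G uh \<noteq> \<infinity>" "F vh \<noteq> \<infinity>" for v
    using that nm(1)[of uh] nm(2)[of vh] nm(1)[of uh] nm(2)[of v]
    by (cases "G uh"; cases "F vh"; cases "F v") (auto simp: Psi_def dual_gap_def inner_diff_right)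
  show ?thesis
  proof (cases "G uh \<noteq> \<infinity> \<and> F vh \<noteq> \<infinity>")
    case True
    then show ?thesis using P D by (simp add: saddle_point_def all_conj_distrib conj_commute)
  next
    case False
    then show ?thesis using dom by blast
  qed
qed

definition dual_trial ::
  "('u::euclidean_space \<Rightarrow> 'v::euclidean_space) \<Rightarrow> ('v \<Rightarrow> ereal) \<Rightarrow> ('v \<Rightarrow> 'v) \<Rightarrow> real
    \<Rightarrow> real \<Rightarrow> 'u \<Rightarrow> 'u \<Rightarrow> 'v \<Rightarrow> real \<Rightarrow> 'v" where
  "dual_trial K F gradH \<beta> tprev uprev u v t =
     (let \<theta> = t / tprev; ubar = u + \<theta> *\<^sub>R (u - uprev)
      in prox (\<beta> * t) F (v + (\<beta> * t) *\<^sub>R (K ubar - gradH v)))"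

definition linesearch_rejects ::
  "('v::euclidean_space \<Rightarrow> real) \<Rightarrow> ('v \<Rightarrow> 'v) \<Rightarrow> real \<Rightarrow> real \<Rightarrow> 'v \<Rightarrow> 'v \<Rightarrow> real \<Rightarrow> bool" where
  "linesearch_rejects H gradH \<beta> \<delta>L v v' t \<longleftrightarrow>
     t * (H v' - H v - gradH v \<bullet> (v' - v)) > \<delta>L / (2 * \<beta>) * (norm (v' - v))\<^sup>2"

text \<open>The initial data are \<open>u 0\<close>, \<open>v 1\<close> and \<open>\<tau> 0\<close>; the value \<open>v 0\<close> plays no role. The linesearch
  at iteration \<open>k\<close> tries \<open>\<rho> ^ j\<close> times the initial step and stops at the first \<open>j\<close> whose trial
  is not rejected. The predicate does not assume that such a \<open>j\<close> exists (otherwise \<open>LEAST\<close> is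
  an unspecified number), so termination of the linesearch is not a hypothesis on a run.\<close>
definition pd_linesearch_run ::
  "('u::euclidean_space \<Rightarrow> 'v::euclidean_space) \<Rightarrow> ('u \<Rightarrow> ereal) \<Rightarrow> ('v \<Rightarrow> ereal)
    \<Rightarrow> ('v \<Rightarrow> real) \<Rightarrow> ('v \<Rightarrow> 'v) \<Rightarrow> real \<Rightarrow> real \<Rightarrow> real \<Rightarrow> real \<Rightarrow> real
    \<Rightarrow> (nat \<Rightarrow> real) \<Rightarrow> (nat \<Rightarrow> real) \<Rightarrow> (nat \<Rightarrow> real) \<Rightarrow> (nat \<Rightarrow> 'u) \<Rightarrow> (nat \<Rightarrow> 'v) \<Rightarrow> bool" where
  "pd_linesearch_run K G F H gradH \<beta> \<gamma> \<rho> \<delta>K \<delta>L \<alpha> \<tau> \<theta> u v \<longleftrightarrow>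
     \<theta> 0 = 1 \<and>
     (\<forall>k\<ge>1.
        u k = prox (\<tau> (k - 1)) G (u (k - 1) - \<tau> (k - 1) *\<^sub>R adjoint K (v k)) \<and>
        \<alpha> k \<in> {1 .. sqrt (1 + \<gamma> * \<theta> (k - 1))} \<and>
        (let step = (\<lambda>j. \<rho> ^ j * min (sqrt \<delta>K / (sqrt \<beta> * onorm K)) (\<tau> (k - 1) * \<alpha> k));
             trial = (\<lambda>j. dual_trial K F gradH \<beta> (\<tau> (k - 1)) (u (k - 1)) (u k) (v k) (step j));
             jk = (LEAST j. \<not> linesearch_rejects H gradH \<beta> \<delta>L (v k) (trial j) (step j))
         in \<tau> k = step jk \<and> v (k + 1) = trial jk \<and> \<theta> k = \<tau> k / \<tau> (k - 1)))"

end

theory Submission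
  imports Defs
begin

text \<open>Every prox step is read as a subgradient inclusion (\<open>prox_subgradient\<close>). The inclusions
  for \<open>G\<close> at \<open>u k\<close> and \<open>u (k + 1)\<close> and for \<open>F\<close> at \<open>v (k + 1)\<close>, tested against a saddle
  point and against neighbouring iterates, combine to one estimate (\<open>one_step_estimate\<close>). Its only indefinite terms are the coupling through \<open>K\<close>, which the
  bound \<open>max_step\<close> on the step sizes absorbs, and the linearisation error of \<open>H\<close>, which the
  acceptance test of the linesearch absorbs; \<open>\<delta>K + \<delta>L < 1\<close> leaves room for both at once.

  The rule \<open>(\<theta> (k + 1))\<^sup>2 \<le> 1 + \<gamma> * \<theta> k\<close> makes the estimate telescope: the energy
  (weighted squared distance to the saddle point plus a multiple of the last primal gap) never increases,
  and it loses at least a sum of nonnegative terms (\<open>energy_decreases\<close>). Hence these terms tend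
  to zero, which controls the gaps, weighted by step sizes, and all increments. The strict
  inequality \<open>\<gamma> < 1\<close> is what keeps a fixed share of the primal gap in that sum.

  To remove the weights the step sizes have to stay away from zero. A monotone energy bounds the
  iterates, so all trial points stay in a ball, where the gradient of \<open>H\<close> is Lipschitz; a short
  enough step is then always accepted (\<open>short_steps_accepted\<close>). The same fact, used for a single
  iteration and before anything is known about boundedness, shows that the linesearch terminates.

  With step sizes bounded below, every cluster point satisfies the optimality conditions, because
  the graph of a subdifferential is closed. The energy relative to this cluster point tends to
  zero along a subsequence, hence along the whole sequence, as it is monotone.\<close>

section \<open>Proximal maps and subgradients\<close>

text \<open>Weierstrass' theorem. If no minimum existed, each point \<open>y\<close> would have a neighbourhood on which
  \<open>f\<close> exceeds some value of \<open>f\<close> on \<open>S\<close>; among the finitely many such values that suffice to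
  cover \<open>S\<close>, the least one is exceeded by itself.\<close>

lemma lsc_attains_min_on_compact:
  fixes f :: "'a::topological_space \<Rightarrow> ereal"
  assumes "compact S" "S \<noteq> {}"
    and lsc: "\<And>x a. x \<in> S \<Longrightarrow> ereal a < f x \<Longrightarrow> eventually (\<lambda>y. ereal a < f y) (nhds x)"
  obtains x where "x \<in> S" "\<And>y. y \<in> S \<Longrightarrow> f x \<le> f y"
proof -
  have "\<exists>x\<in>S. \<forall>y\<in>S. f x \<le> f y"
  proof (rule ccontr)
    assume "\<not> ?thesis"
    then have "\<forall>y\<in>S. \<exists>x\<in>S. f x < f y"
      by (meson not_le)
    then obtain b where b: "\<And>y. y \<in> S \<Longrightarrow> b y \<in> S \<and> f (b y) < f y"
      by metis
    have "\<forall>y\<in>S. \<exists>a U. f (b y) < ereal a \<and> open U \<and> y \<in> U \<and> (\<forall>z\<in>U. ereal a < f z)"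
    proof
      fix y assume y: "y \<in> S"
      obtain a where a: "f (b y) < ereal a" "ereal a < f y"
        using ereal_dense2 b[OF y] by blast
      then show "\<exists>a U. f (b y) < ereal a \<and> open U \<and> y \<in> U \<and> (\<forall>z\<in>U. ereal a < f z)"
        using lsc[OF y a(2)] unfolding eventually_nhds by blast
    qed
    then obtain a U where U: "\<And>y. y \<in> S \<Longrightarrow> f (b y) < ereal (a y)" "\<And>y. y \<in> S \<Longrightarrow> open (U y)"
        "\<And>y. y \<in> S \<Longrightarrow> y \<in> U y" "\<And>y z. y \<in> S \<Longrightarrow> z \<in> U y \<Longrightarrow> ereal (a y) < f z"
      by metis
    obtain D where D: "D \<subseteq> S" "finite D" "S \<subseteq> (\<Union>y\<in>D. U y)"
    proof (rule compactE_image[OF \<open>compact S\<close>, of S U])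
      show "S \<subseteq> (\<Union>y\<in>S. U y)"
        using U(3) by blast
    qed (use U(2) in auto)
    have "D \<noteq> {}"
      using D(3) \<open>S \<noteq> {}\<close> by auto
    then obtain x where x: "x \<in> D" "\<And>y. y \<in> D \<Longrightarrow> f (b x) \<le> f (b y)"
      using ex_is_arg_min_if_finite[OF D(2), of "f \<circ> b"] by (auto simp: is_arg_min_linorder)
    obtain y where "y \<in> D" "b x \<in> U y"
      using D b x(1) by blast
    then have "f (b y) < f (b x)"
      using U(1,4) D(1) by (meson less_trans subsetD)
    then show False
      using x(2)[OF \<open>y \<in> D\<close>] by simp
  qed
  then show thesis
    using that by blast
qed

lemma lsc_fun_eventually_gt:
  assumes "lsc_fun f" "a < f x"
  shows "eventually (\<lambda>y. a < f y) (nhds x)"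
proof -
  have "eventually (\<lambda>y. a < f y) (at x)"
    using assms unfolding lsc_fun_def le_Liminf_iff by blast
  then show ?thesis
    using assms(2) by (auto simp: eventually_at_filter elim: eventually_mono)
qed

lemma lsc_fun_limit_le:
  assumes "lsc_fun f" and lim: "p \<longlonglongrightarrow> x" "c \<longlonglongrightarrow> b" and le: "\<And>n. f (p n) \<le> ereal (c n)"
  shows "f x \<le> ereal b"
proof (rule ccontr)
  assume "\<not> f x \<le> ereal b"
  then obtain a where a: "b < a" "ereal a < f x"
    using ereal_dense2[of "ereal b" "f x"] by (metis less_ereal.simps(1) not_le)
  have "eventually (\<lambda>n. ereal a < f (p n)) sequentially"
    using lsc_fun_eventually_gt[OF assms(1) a(2)] lim(1) by (rule eventually_compose_filterlim)
  moreover have "eventually (\<lambda>n. c n < a) sequentially"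
    using order_tendstoD(2)[OF lim(2) a(1)] .
  ultimately have "eventually (\<lambda>n. False) sequentially"
    by eventually_elim (use le in \<open>metis ereal_less_eq(3) less_le_not_le order_less_le_trans\<close>)
  then show False
    by simp
qed

lemma proper_lsc_convex_not_MInf: "proper_lsc_convex f \<Longrightarrow> f x \<noteq> -\<infinity>"
  by (simp add: proper_lsc_convex_def proper_fun_def)

lemma proper_lsc_convex_finite_point:
  assumes "proper_lsc_convex f"
  obtains x c where "f x = ereal c"
  using assms unfolding proper_lsc_convex_def proper_fun_def by (metis ereal_cases)

text \<open>A substitute for an affine minorant that avoids separation theorems: \<open>f\<close> is bounded below on a
  unit ball around a point of its domain by compactness, and convexity along rays from the centre
  extends this to linear decay outside the ball. It makes the prox objective coercive.\<close>

lemma proper_lsc_convex_lower_bound: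
  fixes f :: "'a::euclidean_space \<Rightarrow> ereal"
  assumes f: "proper_lsc_convex f"
  obtains c where "\<And>y. ereal (- c * (1 + norm (y - x))) \<le> f y"
proof -
  obtain x0 \<phi> where x0: "f x0 = ereal \<phi>"
    using proper_lsc_convex_finite_point[OF f] .
  obtain m where m: "m \<in> cball x0 1" "\<And>y. y \<in> cball x0 1 \<Longrightarrow> f m \<le> f y"
    using lsc_attains_min_on_compact[of "cball x0 1" f] lsc_fun_eventually_gt f
    by (metis cball_eq_empty compact_cball not_one_less_zero proper_lsc_convex_def)
  have "f m \<le> ereal \<phi>"
    using m(2)[of x0] x0 by simp
  then obtain \<mu> where \<mu>: "f m = ereal \<mu>"
    using proper_lsc_convex_not_MInf[OF f, of m] by (cases "f m") auto
  define c where "c = \<bar>\<mu>\<bar> + \<bar>\<phi>\<bar>"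
  have bound: "ereal (- c * (1 + norm (y - x0))) \<le> f y" for y
  proof (cases "norm (y - x0) \<le> 1")
    case True
    then have "ereal \<mu> \<le> f y"
      using m(2)[of y] \<mu> by (simp add: dist_norm norm_minus_commute)
    moreover have "- c * (1 + norm (y - x0)) \<le> \<mu>"
    proof -
      have "- c * (1 + norm (y - x0)) \<le> - c * 1"
        by (rule mult_left_mono_neg) (auto simp: c_def)
      then show ?thesis
        by (simp add: c_def)
    qed
    ultimately show ?thesis
      by (meson ereal_less_eq(3) order_trans)
  next
    case False
    define r where "r = norm (y - x0)"
    have r: "r > 1"
      using False by (simp add: r_def)
    define z where "z = (1 - 1/r) *\<^sub>R x0 + (1/r) *\<^sub>R y"
    have "z - x0 = (1/r) *\<^sub>R (y - x0)"
      by (simp add: z_def algebra_simps)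
    then have "norm (z - x0) = 1"
      using r by (auto simp: r_def)
    then have "ereal \<mu> \<le> f z"
      using m(2)[of z] \<mu> by (simp add: dist_norm norm_minus_commute)
    also have "f z \<le> ereal (1 - 1/r) * f x0 + ereal (1/r) * f y"
      using f r unfolding proper_lsc_convex_def convex_fun_def z_def by simp
    finally have *: "ereal \<mu> \<le> ereal (1 - 1/r) * f x0 + ereal (1/r) * f y" .
    show ?thesis
    proof (cases "f y")
      case (real \<eta>)
      with * x0 have "\<mu> \<le> (1 - 1/r) * \<phi> + (1/r) * \<eta>"
        by simp
      then have "r * \<mu> \<le> r * ((1 - 1/r) * \<phi> + (1/r) * \<eta>)"
        using r by (intro mult_left_mono) auto
      moreover have "r * ((1 - 1/r) * \<phi> + (1/r) * \<eta>) = (r - 1) * \<phi> + \<eta>"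
        using r by (simp add: field_simps)
      ultimately have "r * \<mu> \<le> (r - 1) * \<phi> + \<eta>"
        by simp
      moreover have "r * \<mu> \<ge> r * - \<bar>\<mu>\<bar>" "(r - 1) * \<phi> \<le> (r - 1) * \<bar>\<phi>\<bar>"
        using r by (intro mult_left_mono; simp)+
      ultimately have "- c * (1 + r) \<le> \<eta>"
        using r unfolding c_def by (simp add: algebra_simps)
      then show ?thesis
        by (simp add: real r_def)
    qed (use proper_lsc_convex_not_MInf[OF f] in auto)
  qed
  have "ereal (- (c * (1 + norm (x - x0))) * (1 + norm (y - x))) \<le> f y" for y
  proof -
    have "c * (1 + norm (y - x0)) \<le> c * ((1 + norm (x - x0)) * (1 + norm (y - x)))"
    proof (rule mult_left_mono)
      have "norm (y - x0) \<le> norm (y - x) + norm (x - x0)"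
        using norm_triangle_ineq[of "y - x" "x - x0"] by simp
      moreover have "0 \<le> norm (x - x0) * norm (y - x)"
        by simp
      ultimately show "1 + norm (y - x0) \<le> (1 + norm (x - x0)) * (1 + norm (y - x))"
        unfolding ring_distribs by linarith
    qed (simp add: c_def)
    then show ?thesis
      by (intro order_trans[OF _ bound[of y]]) (simp add: mult.assoc)
  qed
  then show thesis
    by (rule that)
qed

text \<open>As \<^const>\<open>prox\<close> is an arbitrary choice of a minimiser, the content is that one exists: the
  quadratic term beats the linear decay of \<open>f\<close>, so only a closed ball matters.\<close>

lemma prox_minimises:
  fixes f :: "'a::euclidean_space \<Rightarrow> ereal"
  assumes f: "proper_lsc_convex f" and t: "t > 0"
  shows "f (prox t f x) + ereal (1 / (2 * t) * (norm (prox t f x - x))\<^sup>2)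
           \<le> f y + ereal (1 / (2 * t) * (norm (y - x))\<^sup>2)"
proof -
  define q where "q y = 1 / (2 * t) * (norm (y - x))\<^sup>2" for y
  define g where "g y = f y + ereal (q y)" for y
  obtain x0 \<phi> where x0: "f x0 = ereal \<phi>"
    using proper_lsc_convex_finite_point[OF f] .
  obtain c where c: "\<And>y. ereal (- c * (1 + norm (y - x))) \<le> f y"
    using proper_lsc_convex_lower_bound[OF f, of x] by blast
  have "filterlim (\<lambda>s. - c + s * (- c + 1 / (2 * t) * s)) at_top at_top"
    using t by (intro filterlim_tendsto_add_at_top[OF tendsto_const] filterlim_at_top_mult_at_top
        filterlim_tendsto_pos_mult_at_top[OF tendsto_const] filterlim_ident) auto
  moreover have "(\<lambda>s. - c + s * (- c + 1 / (2 * t) * s)) = (\<lambda>s. - c * (1 + s) + 1 / (2 * t) * s\<^sup>2)"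
    by (simp add: fun_eq_iff algebra_simps power2_eq_square)
  ultimately have "filterlim (\<lambda>s. - c * (1 + s) + 1 / (2 * t) * s\<^sup>2) at_top at_top"
    by simp
  then have "eventually (\<lambda>s. \<phi> + q x0 < - c * (1 + s) + 1 / (2 * t) * s\<^sup>2) at_top"
    by (simp add: filterlim_at_top_dense)
  then obtain R where R: "\<And>s. s \<ge> R \<Longrightarrow> \<phi> + q x0 < - c * (1 + s) + 1 / (2 * t) * s\<^sup>2"
    by (auto simp: eventually_at_top_linorder)
  have far: "g x0 < g y" if "R \<le> norm (y - x)" for y
  proof -
    have "g x0 < ereal (- c * (1 + norm (y - x))) + ereal (q y)"
      using R[OF that] x0 by (simp add: g_def q_def)
    also have "\<dots> \<le> g y"
      unfolding g_def by (intro add_right_mono c)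
    finally show ?thesis .
  qed
  have lsc: "eventually (\<lambda>z. ereal a < g z) (nhds y)" if "ereal a < g y" for y a
  proof -
    have "ereal (a - q y) < f y"
      using that by (cases "f y") (auto simp: g_def)
    then obtain b where b: "a - q y < b" "ereal b < f y"
      using ereal_dense2[of "ereal (a - q y)" "f y"] by auto
    have "isCont q y"
      unfolding q_def by (intro continuous_intros)
    then have "filterlim q (nhds (q y)) (nhds y)"
      by (simp add: continuous_at tendsto_at_iff_tendsto_nhds)
    then have "eventually (\<lambda>z. a - b < q z) (nhds y)"
      using order_tendstoD(1)[of q "q y" "nhds y" "a - b"] b by simp
    moreover have "eventually (\<lambda>z. ereal b < f z) (nhds y)"
      using lsc_fun_eventually_gt b(2) f by (metis proper_lsc_convex_def)
    ultimately show ?thesis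
    proof eventually_elim
      case (elim z)
      then show ?case
        by (cases "f z") (auto simp: g_def)
    qed
  qed
  define S where "S = cball x (max R (norm (x0 - x)))"
  have "x0 \<in> S" "compact S"
    by (auto simp: S_def dist_norm norm_minus_commute)
  then obtain p where p: "p \<in> S" "\<And>y. y \<in> S \<Longrightarrow> g p \<le> g y"
    using lsc_attains_min_on_compact[of S g] lsc by blast
  have "g p \<le> g y" for y
  proof (cases "y \<in> S")
    case False
    then have "R \<le> norm (y - x)"
      by (auto simp: S_def dist_norm norm_minus_commute)
    then show ?thesis
      using far[of y] p(2)[OF \<open>x0 \<in> S\<close>] by simp
  qed (use p in auto)
  then have "is_arg_min g (\<lambda>_. True) p"
    by (simp add: is_arg_min_linorder)
  then have "is_arg_min g (\<lambda>_. True) (arg_min g (\<lambda>_. True))"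
    unfolding arg_min_def by (rule someI)
  moreover have "prox t f x = arg_min g (\<lambda>_. True)"
    unfolding prox_def g_def[abs_def] q_def by (rule refl)
  ultimately show ?thesis
    by (simp add: is_arg_min_linorder g_def q_def)
qed

definition subgradient :: "('a::real_inner \<Rightarrow> ereal) \<Rightarrow> 'a \<Rightarrow> 'a \<Rightarrow> bool" where
  "subgradient f p w \<longleftrightarrow> \<bar>f p\<bar> \<noteq> \<infinity> \<and> (\<forall>z. f p + ereal (w \<bullet> (z - p)) \<le> f z)"

lemma subgradientD:
  assumes "subgradient f p w" "f z = ereal b"
  shows "real_of_ereal (f p) + w \<bullet> (z - p) \<le> b"
proof -
  have "f p + ereal (w \<bullet> (z - p)) \<le> f z" "\<bar>f p\<bar> \<noteq> \<infinity>"
    using assms(1) unfolding subgradient_def by auto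
  then have "f p + ereal (w \<bullet> (z - p)) \<le> ereal b"
    using assms(2) by simp
  then show ?thesis
    using \<open>\<bar>f p\<bar> \<noteq> \<infinity>\<close> by (cases "f p") auto
qed

text \<open>First-order optimality: compare \<open>p\<close> with the points \<open>(1 - s) p + s z\<close>, divide by \<open>s\<close> and let
  \<open>s\<close> tend to zero.\<close>

lemma prox_subgradient:
  fixes f :: "'a::euclidean_space \<Rightarrow> ereal"
  assumes f: "proper_lsc_convex f" and t: "t > 0"
  shows "subgradient f (prox t f x) ((1 / t) *\<^sub>R (x - prox t f x))"
proof -
  define p \<kappa> where "p = prox t f x" and "\<kappa> = 1 / (2 * t)"
  have min: "f p + ereal (\<kappa> * (norm (p - x))\<^sup>2) \<le> f y + ereal (\<kappa> * (norm (y - x))\<^sup>2)" for y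
    unfolding p_def \<kappa>_def by (rule prox_minimises[OF f t])
  obtain x0 \<phi> where "f x0 = ereal \<phi>"
    using proper_lsc_convex_finite_point[OF f] .
  then obtain a where a: "f p = ereal a"
    using min[of x0] proper_lsc_convex_not_MInf[OF f, of p] by (cases "f p") auto
  have "a + (1/t) * ((x - p) \<bullet> (z - p)) \<le> b" if z: "f z = ereal b" for z b
  proof -
    have "a - b \<le> (1/t) * ((p - x) \<bullet> (z - p)) + s * (\<kappa> * (norm (z - p))\<^sup>2)"
      if s: "s > 0" "s < 1" for s
    proof -
      define y where "y = (1 - s) *\<^sub>R p + s *\<^sub>R z"
      have "f y \<le> ereal (1 - s) * f p + ereal s * f z"
        using f s unfolding proper_lsc_convex_def convex_fun_def y_def by simp
      then have "f y \<le> ereal ((1 - s) * a + s * b)"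
        using a z by simp
      then have "ereal (a + \<kappa> * (norm (p - x))\<^sup>2)
          \<le> ereal ((1 - s) * a + s * b) + ereal (\<kappa> * (norm (y - x))\<^sup>2)"
        using order_trans[OF min[of y] add_right_mono, of "ereal ((1 - s) * a + s * b)"] a by simp
      then have "s * (a - b) \<le> \<kappa> * ((norm (y - x))\<^sup>2 - (norm (p - x))\<^sup>2)"
        by (simp add: algebra_simps)
      also have "y - x = (p - x) + s *\<^sub>R (z - p)"
        by (simp add: y_def algebra_simps)
      also have "(norm ((p - x) + s *\<^sub>R (z - p)))\<^sup>2 - (norm (p - x))\<^sup>2
          = s * (2 * ((p - x) \<bullet> (z - p)) + s * (norm (z - p))\<^sup>2)"
        by (simp only: power2_norm_eq_inner) (simp add: algebra_simps inner_commute)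
      finally have "s * (a - b) \<le> s * ((1/t) * ((p - x) \<bullet> (z - p)) + s * (\<kappa> * (norm (z - p))\<^sup>2))"
        using t by (simp add: field_simps \<kappa>_def)
      then show ?thesis
        using s by simp
    qed
    then have "eventually (\<lambda>s. a - b \<le> (1/t) * ((p - x) \<bullet> (z - p)) + s * (\<kappa> * (norm (z - p))\<^sup>2))
        (at_right 0)"
      unfolding eventually_at_right_field by (intro exI[of _ 1]) auto
    moreover have "((\<lambda>s. (1/t) * ((p - x) \<bullet> (z - p)) + s * (\<kappa> * (norm (z - p))\<^sup>2))
        \<longlongrightarrow> (1/t) * ((p - x) \<bullet> (z - p)) + 0 * (\<kappa> * (norm (z - p))\<^sup>2)) (at_right 0)"
      by (intro tendsto_intros)
    ultimately have "a - b \<le> (1/t) * ((p - x) \<bullet> (z - p)) + 0 * (\<kappa> * (norm (z - p))\<^sup>2)"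
      by (intro tendsto_lowerbound) auto
    then show ?thesis
      by (simp add: diff_divide_distrib algebra_simps)
  qed
  then have "f p + ereal (((1 / t) *\<^sub>R (x - p)) \<bullet> (z - p)) \<le> f z" for z
    using a proper_lsc_convex_not_MInf[OF f, of z] by (cases "f z") auto
  then show ?thesis
    using a by (simp add: subgradient_def flip: p_def)
qed

text \<open>The graph of the subdifferential is closed. This turns vanishing residuals along the iteration
  into optimality conditions at cluster points.\<close>

lemma subgradient_limit:
  fixes f :: "'a::real_inner \<Rightarrow> ereal"
  assumes f: "proper_lsc_convex f" and sub: "\<And>n. subgradient f (p n) (w n)"
    and lim: "p \<longlonglongrightarrow> p'" "w \<longlonglongrightarrow> w'"
  shows "subgradient f p' w'"
proof -
  have le: "f p' \<le> ereal (b - w' \<bullet> (z - p'))" if z: "f z = ereal b" for z b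
  proof (rule lsc_fun_limit_le[of f p _ "\<lambda>n. b - w n \<bullet> (z - p n)"])
    show "lsc_fun f"
      using f by (simp add: proper_lsc_convex_def)
    show "(\<lambda>n. b - w n \<bullet> (z - p n)) \<longlonglongrightarrow> b - w' \<bullet> (z - p')"
      by (intro tendsto_intros lim)
    show "f (p n) \<le> ereal (b - w n \<bullet> (z - p n))" for n
      using subgradientD[OF sub z, of n] sub[of n] by (cases "f (p n)") (auto simp: subgradient_def)
  qed (rule lim)
  obtain x0 \<phi> where "f x0 = ereal \<phi>"
    using proper_lsc_convex_finite_point[OF f] .
  then obtain a where a: "f p' = ereal a"
    using le[of x0 \<phi>] proper_lsc_convex_not_MInf[OF f, of p'] by (cases "f p'") auto
  have "f p' + ereal (w' \<bullet> (z - p')) \<le> f z" for z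
    using le[of z] a proper_lsc_convex_not_MInf[OF f, of z] by (cases "f z") (auto simp: algebra_simps)
  then show ?thesis
    using a by (simp add: subgradient_def)
qed

text \<open>Monotonicity of the subdifferential at \<open>p\<close> and at the prox point. The bound stays finite as \<open>t\<close>
  tends to zero, so it holds for all trial points of a linesearch at once.\<close>

lemma prox_norm_bound:
  fixes f :: "'a::euclidean_space \<Rightarrow> ereal"
  assumes f: "proper_lsc_convex f" and t: "t > 0" and sub: "subgradient f p w"
  shows "norm (prox t f x) \<le> norm x + 2 * norm p + t * norm w"
proof -
  define q where "q = prox t f x"
  have q: "subgradient f q ((1 / t) *\<^sub>R (x - q))"
    unfolding q_def by (rule prox_subgradient[OF f t])
  obtain a b where ab: "f p = ereal a" "f q = ereal b"
    using sub q unfolding subgradient_def by (metis ereal_cases abs_ereal.simps(2,3))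
  have "a + w \<bullet> (q - p) \<le> b" "b + (1/t) * ((x - q) \<bullet> (p - q)) \<le> a"
    using subgradientD[OF sub ab(2)] subgradientD[OF q ab(1)] ab by auto
  then have "(1/t) * ((x - q) \<bullet> (p - q)) \<le> - (w \<bullet> (q - p))"
    by linarith
  then have "(x - q) \<bullet> (p - q) \<le> - t * (w \<bullet> (q - p))"
    using t by (simp add: field_simps)
  then have "(q - p) \<bullet> (q - p) \<le> (x - p - t *\<^sub>R w) \<bullet> (q - p)"
    by (simp add: algebra_simps inner_commute)
  also have "\<dots> \<le> norm (x - p - t *\<^sub>R w) * norm (q - p)"
    by (rule norm_cauchy_schwarz)
  finally have "norm (q - p) * norm (q - p) \<le> norm (x - p - t *\<^sub>R w) * norm (q - p)"
    by (simp add: power2_norm_eq_inner flip: power2_eq_square)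
  then have "norm (q - p) \<le> norm (x - p - t *\<^sub>R w)"
    by (cases "q = p") auto
  also have "\<dots> \<le> norm x + norm p + t * norm w"
    using norm_triangle_ineq4[of "x - p" "t *\<^sub>R w"] norm_triangle_ineq4[of x p] t by simp
  finally show ?thesis
    using norm_triangle_ineq2[of q p] by (simp add: q_def)
qed

section \<open>Convex functions with locally Lipschitz gradient\<close>

lemma convex_GDERIV_above_tangent:
  fixes H :: "'a::real_inner \<Rightarrow> real"
  assumes "convex_on UNIV H" and grad: "GDERIV H x :> g"
  shows "H x + g \<bullet> (y - x) \<le> H y"
proof -
  define h where "h s = H (x + s *\<^sub>R (y - x))" for s
  have "convex_on UNIV h"
  proof (rule convex_onI)
    fix t a b :: real assume "0 < t" "t < 1"
    then have "H ((1 - t) *\<^sub>R (x + a *\<^sub>R (y - x)) + t *\<^sub>R (x + b *\<^sub>R (y - x)))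
        \<le> (1 - t) * h a + t * h b"
      using convex_onD[OF assms(1), of t] by (simp add: h_def)
    moreover have "(1 - t) *\<^sub>R (x + a *\<^sub>R (y - x)) + t *\<^sub>R (x + b *\<^sub>R (y - x))
        = x + ((1 - t) * a + t * b) *\<^sub>R (y - x)"
      by (simp add: algebra_simps)
    ultimately show "h ((1 - t) *\<^sub>R a + t *\<^sub>R b) \<le> (1 - t) * h a + t * h b"
      by (simp add: h_def)
  qed simp
  moreover have "(h has_field_derivative ((y - x) \<bullet> g)) (at 0)"
  proof -
    have "((\<lambda>s. x + s *\<^sub>R (y - x)) has_derivative (\<lambda>s. s *\<^sub>R (y - x))) (at 0)"
      by (auto intro!: derivative_eq_intros)
    moreover have "(H has_derivative (\<lambda>d. d \<bullet> g)) (at (x + 0 *\<^sub>R (y - x)))"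
      using grad by (simp add: gderiv_def)
    ultimately have "((\<lambda>s. H (x + s *\<^sub>R (y - x))) has_derivative (\<lambda>s. (s *\<^sub>R (y - x)) \<bullet> g)) (at 0)"
      by (rule has_derivative_compose)
    then show ?thesis
      unfolding h_def has_field_derivative_def by (rule has_derivative_eq_rhs) (auto simp: mult.commute)
  qed
  ultimately have "((y - x) \<bullet> g) * (1 - 0) \<le> h 1 - h 0"
    by (intro convex_on_imp_above_tangent[where A = UNIV]) auto
  then show ?thesis
    by (simp add: h_def inner_commute)
qed

lemma locally_lipschitz_on_cball:
  fixes g :: "'a::euclidean_space \<Rightarrow> 'b::metric_space"
  assumes "\<forall>y. \<exists>e>0. \<exists>L. L-lipschitz_on (ball y e) g"
  obtains L where "L-lipschitz_on (cball x R) g"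
proof -
  have "local_lipschitz {0::real} (cball x R) (\<lambda>_. g)"
  proof (rule local_lipschitzI)
    fix t :: real and y
    obtain e L where "e > 0" "L-lipschitz_on (ball y e) g"
      using assms by blast
    then have "L-lipschitz_on (cball y (e/2) \<inter> cball x R) g"
      by (elim lipschitz_on_subset) auto
    then show "\<exists>u>0. \<exists>L. \<forall>t \<in> cball t u \<inter> {0}. L-lipschitz_on (cball y u \<inter> cball x R) g"
      using \<open>e > 0\<close> by (intro exI[of _ "e/2"]) auto
  qed
  then show thesis
    using that local_lipschitz_compact_implies_lipschitz[of "{0}" "cball x R" "\<lambda>_. g"]
    by (metis compact_cball compact_sing continuous_on_const insertI1)
qed

text \<open>The tangent inequality at \<open>y\<close> already bounds the linearisation error at \<open>x\<close> by the gradient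
  difference. The constant is twice the optimal one, which only affects the value of the lower
  bound on the step sizes.\<close>

lemma convex_bregman_le_lipschitz:
  fixes H :: "'a::real_inner \<Rightarrow> real"
  assumes "convex_on UNIV H" and grad: "\<forall>y. GDERIV H y :> g y"
    and L: "L-lipschitz_on S g" and xy: "x \<in> S" "y \<in> S"
  shows "H y - H x - g x \<bullet> (y - x) \<le> L * (norm (y - x))\<^sup>2"
proof -
  have "H y + g y \<bullet> (x - y) \<le> H x"
    using convex_GDERIV_above_tangent[OF assms(1)] grad by blast
  then have "H y - H x - g x \<bullet> (y - x) \<le> (g y - g x) \<bullet> (y - x)"
    by (simp add: algebra_simps)
  also have "\<dots> \<le> norm (g y - g x) * norm (y - x)"
    by (rule norm_cauchy_schwarz)
  also have "\<dots> \<le> (L * norm (y - x)) * norm (y - x)"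
    using lipschitz_onD[OF L xy(2,1)] by (intro mult_right_mono) (auto simp: dist_norm)
  finally show ?thesis
    by (simp add: power2_eq_square mult.assoc)
qed

section \<open>Optimality conditions and elementary limits\<close>

lemma saddle_point_of_subgradients:
  fixes K :: "'u::euclidean_space \<Rightarrow> 'v::euclidean_space"
  assumes K: "linear K" and G: "proper_lsc_convex G" and F: "proper_lsc_convex F"
    and H: "convex_on UNIV H" "GDERIV H vh :> g"
    and subG: "subgradient G uh (- adjoint K vh)" and subF: "subgradient F vh (K uh - g)"
  shows "saddle_point K G F H uh vh"
proof -
  obtain a b where ab: "G uh = ereal a" "F vh = ereal b"
    using subG subF unfolding subgradient_def by (metis ereal_cases abs_ereal.simps(2,3))
  have "0 \<le> primal_gap K G uh vh x" for x
    using subgradientD[OF subG, of x] proper_lsc_convex_not_MInf[OF G, of x] ab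
    by (cases "G x") (auto simp: primal_gap_def)
  moreover have "0 \<le> dual_gap K F H uh vh y" for y
    using subgradientD[OF subF, of y] proper_lsc_convex_not_MInf[OF F, of y] ab
      convex_GDERIV_above_tangent[OF H, of y]
    by (cases "F y") (auto simp: dual_gap_def inner_diff_left)
  ultimately show ?thesis
    using G F ab by (subst saddle_point_iff[OF K]) (auto simp: proper_lsc_convex_def)
qed

lemma inner_three_point:
  fixes a b c :: "'a::real_inner"
  shows "(b - a) \<bullet> (c - b) = ((norm (a - c))\<^sup>2 - (norm (b - c))\<^sup>2 - (norm (b - a))\<^sup>2) / 2"
  by (simp add: power2_norm_eq_inner algebra_simps inner_commute)

lemma decreasing_energy_limits:
  fixes e r :: "nat \<Rightarrow> real"
  assumes "\<And>k. k \<ge> N \<Longrightarrow> e (k + 1) + r k \<le> e k" "\<And>k. k \<ge> N \<Longrightarrow> 0 \<le> e k" "\<And>k. k \<ge> N \<Longrightarrow> 0 \<le> r k"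
  obtains l where "e \<longlonglongrightarrow> l" "r \<longlonglongrightarrow> 0"
proof -
  have "decseq (\<lambda>k. e (k + N))"
  proof (rule decseq_SucI)
    show "e (Suc k + N) \<le> e (k + N)" for k
      using assms(1,3)[of "k + N"] by simp
  qed
  moreover have "\<forall>k. 0 \<le> e (k + N)"
    using assms(2) by simp
  ultimately obtain l where "(\<lambda>k. e (k + N)) \<longlonglongrightarrow> l"
    by (rule decseq_convergent)
  then have l: "e \<longlonglongrightarrow> l"
    by (rule LIMSEQ_offset)
  then have "(\<lambda>k. e (k + 1)) \<longlonglongrightarrow> l"
    by (rule LIMSEQ_ignore_initial_segment)
  with l have "(\<lambda>k. e k - e (k + 1)) \<longlonglongrightarrow> l - l"
    by (intro tendsto_diff)
  then have "(\<lambda>k. e k - e (k + 1)) \<longlonglongrightarrow> 0"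
    by simp
  moreover have "eventually (\<lambda>k. 0 \<le> r k) sequentially"
    "eventually (\<lambda>k. r k \<le> e k - e (k + 1)) sequentially"
    using assms(1,3) by (auto simp: eventually_sequentially intro!: exI[of _ N] simp: le_diff_eq add.commute)
  ultimately have "r \<longlonglongrightarrow> 0"
    using real_tendsto_sandwich[of "\<lambda>_. 0" r sequentially "\<lambda>k. e k - e (k + 1)" 0] by simp
  with l show thesis
    by (rule that)
qed

lemma tendsto_zero_if_scaled_le:
  fixes x r :: "nat \<Rightarrow> real"
  assumes "c > 0" "r \<longlonglongrightarrow> 0" "\<And>k. k \<ge> N \<Longrightarrow> c * x k \<le> r k" "\<And>k. k \<ge> N \<Longrightarrow> 0 \<le> x k"
  shows "x \<longlonglongrightarrow> 0"
proof (rule real_tendsto_sandwich[of "\<lambda>_. 0" x _ "\<lambda>k. r k / c"])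
  show "(\<lambda>k. r k / c) \<longlonglongrightarrow> 0"
    using tendsto_divide[OF assms(2) tendsto_const, of c] assms(1) by simp
  show "eventually (\<lambda>k. 0 \<le> x k) sequentially"
    using assms(4) by (auto simp: eventually_sequentially)
  show "eventually (\<lambda>k. x k \<le> r k / c) sequentially"
    using assms(1,3) by (auto simp: eventually_sequentially field_simps)
qed simp

lemma tendsto_zero_if_power2_norm:
  fixes x :: "nat \<Rightarrow> 'a::real_normed_vector"
  assumes "(\<lambda>k. (norm (x k))\<^sup>2) \<longlonglongrightarrow> 0"
  shows "x \<longlonglongrightarrow> 0"
  using tendsto_real_sqrt[OF assms] by (simp add: tendsto_norm_zero_iff)

section \<open>Well-definedness of the linesearch\<close>

locale primal_dual_linesearch =
  fixes K :: "'u::euclidean_space \<Rightarrow> 'v::euclidean_space"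
    and G :: "'u \<Rightarrow> ereal" and F :: "'v \<Rightarrow> ereal"
    and H :: "'v \<Rightarrow> real" and gradH :: "'v \<Rightarrow> 'v"
    and \<beta> \<gamma> \<rho> \<delta>K \<delta>L :: real
    and \<alpha> \<tau> \<theta> :: "nat \<Rightarrow> real"
    and u :: "nat \<Rightarrow> 'u" and v :: "nat \<Rightarrow> 'v"
  assumes linear_K: "linear K" and K_nonzero: "K \<noteq> (\<lambda>_. 0)"
    and F: "proper_lsc_convex F" and G: "proper_lsc_convex G"
    and H_convex: "convex_on UNIV H"
    and H_grad: "\<forall>y. GDERIV H y :> gradH y"
    and gradH_lipschitz: "\<forall>y. \<exists>e>0. \<exists>L. L-lipschitz_on (ball y e) gradH"
    and \<beta>: "\<beta> > 0" and \<tau>0: "\<tau> 0 > 0"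
    and \<gamma>: "\<gamma> \<in> {0<..<1}" and \<rho>: "\<rho> \<in> {0<..<1}"
    and \<delta>K: "\<delta>K \<in> {0<..<1}" and \<delta>L: "\<delta>L \<in> {0<..<1}" and \<delta>: "\<delta>K + \<delta>L < 1"
    and run: "pd_linesearch_run K G F H gradH \<beta> \<gamma> \<rho> \<delta>K \<delta>L \<alpha> \<tau> \<theta> u v"
begin

definition max_step :: real where
  "max_step = sqrt \<delta>K / (sqrt \<beta> * onorm K)"

definition step :: "nat \<Rightarrow> nat \<Rightarrow> real" where
  "step k j = \<rho> ^ j * min max_step (\<tau> (k - 1) * \<alpha> k)"

definition trial :: "nat \<Rightarrow> nat \<Rightarrow> 'v" where
  "trial k j = dual_trial K F gradH \<beta> (\<tau> (k - 1)) (u (k - 1)) (u k) (v k) (step k j)"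

definition rejected :: "nat \<Rightarrow> nat \<Rightarrow> bool" where
  "rejected k j \<longleftrightarrow> linesearch_rejects H gradH \<beta> \<delta>L (v k) (trial k j) (step k j)"

definition first_accepted :: "nat \<Rightarrow> nat" where
  "first_accepted k = (LEAST j. \<not> rejected k j)"

lemma bounded_linear_K: "bounded_linear K"
  using linear_K linear_conv_bounded_linear by blast

lemma norm_K_le: "norm (K x) \<le> onorm K * norm x"
  by (rule onorm[OF bounded_linear_K])

lemma onorm_K_pos: "onorm K > 0"
  using onorm_pos_lt[OF bounded_linear_K] K_nonzero by blast

lemma max_step_pos: "max_step > 0"
  using \<delta>K \<beta> onorm_K_pos by (simp add: max_step_def)

lemma \<theta>_0: "\<theta> 0 = 1"
  using run by (simp add: pd_linesearch_run_def)

lemma run_step: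
  assumes "k \<ge> 1"
  shows "u k = prox (\<tau> (k - 1)) G (u (k - 1) - \<tau> (k - 1) *\<^sub>R adjoint K (v k))"
    and "\<alpha> k \<in> {1 .. sqrt (1 + \<gamma> * \<theta> (k - 1))}"
    and "\<tau> k = step k (first_accepted k)"
    and "v (k + 1) = trial k (first_accepted k)"
    and "\<theta> k = \<tau> k / \<tau> (k - 1)"
  using run assms
  unfolding pd_linesearch_run_def Let_def step_def trial_def first_accepted_def rejected_def max_step_def
  by blast+

lemma isCont_gradH: "isCont gradH y"
proof -
  obtain e L where "e > 0" "L-lipschitz_on (ball y e) gradH"
    using gradH_lipschitz by blast
  then show ?thesis
    using lipschitz_on_continuous_on continuous_on_eq_continuous_at
    by (metis centre_in_ball open_ball)
qed

text \<open>Uniform over all bounded data: the trial points lie in a fixed ball by \<open>prox_norm_bound\<close>, and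
  with a Lipschitz constant \<open>L\<close> of the gradient there, the acceptance test holds as soon as
  \<open>t * L \<le> \<delta>L / (2 * \<beta>)\<close>. The condition \<open>t \<le> 2 * tp\<close> bounds the extrapolation.\<close>

lemma short_steps_accepted:
  obtains s where "s > 0"
    "\<And>tp a b w t. \<lbrakk>0 < tp; 0 < t; t \<le> max_step; t \<le> 2 * tp; t \<le> s; norm a \<le> M; norm b \<le> M; norm w \<le> M\<rbrakk>
      \<Longrightarrow> \<not> linesearch_rejects H gradH \<beta> \<delta>L w (dual_trial K F gradH \<beta> tp a b w t) t"
proof -
  obtain L0 where L0: "L0-lipschitz_on (cball 0 M) gradH"
    using locally_lipschitz_on_cball[OF gradH_lipschitz] .
  obtain p0 w0 where sub: "subgradient F p0 w0"
    using prox_subgradient[OF F zero_less_one] by blast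
  define N where "N = norm (gradH 0) + L0 * M"
  define C where "C = onorm K * (5 * M) + N"
  define R where "R = M + \<beta> * max_step * C + 2 * norm p0 + \<beta> * max_step * norm w0"
  obtain L where L: "L-lipschitz_on (cball 0 R) gradH"
    using locally_lipschitz_on_cball[OF gradH_lipschitz] .
  have L_nonneg: "L \<ge> 0"
    using lipschitz_on_nonneg[OF L] .
  \<comment> \<open>\<open>L + 1\<close> guards against \<open>L = 0\<close>.\<close>
  define s where "s = \<delta>L / (2 * \<beta> * (L + 1))"
  have s: "s > 0"
    using \<delta>L \<beta> L_nonneg by (simp add: s_def)
  have "\<not> linesearch_rejects H gradH \<beta> \<delta>L w (dual_trial K F gradH \<beta> tp a b w t) t"
    if t: "0 < tp" "0 < t" "t \<le> max_step" "t \<le> 2 * tp" "t \<le> s"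
      and abw: "norm a \<le> M" "norm b \<le> M" "norm w \<le> M" for tp a b w t
  proof -
    have M: "M \<ge> 0"
      using abw(1) norm_ge_zero order_trans by blast
    have bt: "0 < \<beta> * t" "\<beta> * t \<le> \<beta> * max_step"
      using \<beta> t by auto
    define ub where "ub = b + (t / tp) *\<^sub>R (b - a)"
    define x where "x = w + (\<beta> * t) *\<^sub>R (K ub - gradH w)"
    define q where "q = dual_trial K F gradH \<beta> tp a b w t"
    have "norm ub \<le> norm b + (t / tp) * norm (b - a)"
      unfolding ub_def using norm_triangle_ineq[of b "(t / tp) *\<^sub>R (b - a)"] t by simp
    also have "\<dots> \<le> M + 2 * (2 * M)"
    proof (intro add_mono mult_mono)
      show "t / tp \<le> 2"
        using t by (simp add: field_simps)
      show "norm (b - a) \<le> 2 * M"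
        using norm_triangle_ineq4[of b a] abw by simp
    qed (use abw t in auto)
    finally have "onorm K * norm ub \<le> onorm K * (5 * M)"
      using onorm_K_pos by (intro mult_left_mono) auto
    then have "norm (K ub) \<le> onorm K * (5 * M)"
      using norm_K_le[of ub] by linarith
    moreover have "norm (gradH w) \<le> N"
    proof -
      have "dist (gradH w) (gradH 0) \<le> L0 * dist w 0"
        using lipschitz_onD[OF L0, of w 0] abw M by simp
      also have "\<dots> \<le> L0 * M"
        using abw lipschitz_on_nonneg[OF L0] by (intro mult_left_mono) auto
      finally show ?thesis
        using norm_triangle_sub[of "gradH w" "gradH 0"] by (simp add: N_def dist_norm)
    qed
    ultimately have C: "norm (K ub - gradH w) \<le> C"
      using norm_triangle_ineq4[of "K ub" "gradH w"] by (simp add: C_def)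
    have "norm x \<le> norm w + \<beta> * t * norm (K ub - gradH w)"
      unfolding x_def using norm_triangle_ineq[of w "(\<beta> * t) *\<^sub>R (K ub - gradH w)"] bt by simp
    also have "\<dots> \<le> M + \<beta> * max_step * C"
      using bt abw C by (intro add_mono mult_mono[of "\<beta> * t" "\<beta> * max_step"]) auto
    finally have "norm x \<le> M + \<beta> * max_step * C" .
    moreover have "norm q \<le> norm x + 2 * norm p0 + \<beta> * t * norm w0"
      unfolding q_def dual_trial_def Let_def
      using prox_norm_bound[OF F bt(1) sub, of x] by (simp add: x_def ub_def)
    moreover have "\<beta> * t * norm w0 \<le> \<beta> * max_step * norm w0"
      using bt by (intro mult_right_mono) auto
    ultimately have "q \<in> cball 0 R"
      by (simp add: R_def)
    moreover have "w \<in> cball 0 R"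
    proof -
      have "0 \<le> C"
        using C norm_ge_zero order_trans by blast
      then have "0 \<le> \<beta> * max_step * C" "0 \<le> \<beta> * max_step * norm w0"
        using \<beta> max_step_pos by auto
      then show ?thesis
        using abw norm_ge_zero[of p0] unfolding R_def mem_cball_0 by linarith
    qed
    ultimately have "H q - H w - gradH w \<bullet> (q - w) \<le> L * (norm (q - w))\<^sup>2"
      using convex_bregman_le_lipschitz[OF H_convex H_grad L] by blast
    then have "t * (H q - H w - gradH w \<bullet> (q - w)) \<le> t * (L * (norm (q - w))\<^sup>2)"
      using t by (intro mult_left_mono) auto
    also have "\<dots> = (t * L) * (norm (q - w))\<^sup>2"
      by simp
    also have "\<dots> \<le> (s * (L + 1)) * (norm (q - w))\<^sup>2"
      using t L_nonneg s by (intro mult_right_mono mult_mono) auto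
    also have "s * (L + 1) = \<delta>L / (2 * \<beta>)"
      using L_nonneg by (simp add: s_def)
    finally show ?thesis
      unfolding linesearch_rejects_def q_def[symmetric] by simp
  qed
  with s show thesis
    by (rule that)
qed

text \<open>The three hypotheses on the previous iteration are the invariant of the run; the constant \<open>2\<close>
  is preserved since \<open>\<theta> \<le> 2\<close> gives \<open>\<alpha>\<^sup>2 \<le> 1 + \<gamma> * 2 \<le> 4\<close>. The induction that
  discharges them is \<open>\<tau>_\<theta>_bounds\<close>.\<close>

lemma step_bounds:
  assumes k: "k \<ge> 1" and prev: "\<tau> (k - 1) > 0" "0 < \<theta> (k - 1)" "\<theta> (k - 1) \<le> 2"
  shows "0 < step k j" "step k j \<le> max_step" "step k j \<le> \<tau> (k - 1) * \<alpha> k" "\<alpha> k \<le> 2"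
    "(\<alpha> k)\<^sup>2 \<le> 1 + \<gamma> * \<theta> (k - 1)"
proof -
  have \<alpha>: "1 \<le> \<alpha> k" "\<alpha> k \<le> sqrt (1 + \<gamma> * \<theta> (k - 1))"
    using run_step(2)[OF k] by auto
  have pos: "0 \<le> 1 + \<gamma> * \<theta> (k - 1)"
    using prev \<gamma> by simp
  show sq: "(\<alpha> k)\<^sup>2 \<le> 1 + \<gamma> * \<theta> (k - 1)"
    using \<alpha> pos power_mono[of "\<alpha> k" "sqrt (1 + \<gamma> * \<theta> (k - 1))" 2] by simp
  have "\<gamma> * \<theta> (k - 1) \<le> 1 * 2"
    using prev \<gamma> by (intro mult_mono) auto
  then have "(\<alpha> k)\<^sup>2 \<le> 2\<^sup>2"
    using sq by simp
  then show "\<alpha> k \<le> 2"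
    by (rule power2_le_imp_le) simp
  define m where "m = min max_step (\<tau> (k - 1) * \<alpha> k)"
  have m: "0 < m" "m \<le> max_step" "m \<le> \<tau> (k - 1) * \<alpha> k"
    using prev \<alpha> max_step_pos by (auto simp: m_def)
  have \<rho>j: "0 < \<rho> ^ j" "\<rho> ^ j \<le> 1"
    using \<rho> by (auto simp: power_le_one)
  have "step k j \<le> m"
    using mult_right_mono[OF \<rho>j(2), of m] m by (simp add: step_def m_def)
  then show "step k j \<le> max_step" "step k j \<le> \<tau> (k - 1) * \<alpha> k"
    using m by auto
  show "0 < step k j"
    using \<rho>j m by (simp add: step_def m_def)
qed

lemma linesearch_terminates_if:
  assumes k: "k \<ge> 1" and prev: "\<tau> (k - 1) > 0" "0 < \<theta> (k - 1)" "\<theta> (k - 1) \<le> 2"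
  shows "\<not> rejected k (first_accepted k)"
proof -
  define M where "M = norm (u (k - 1)) + norm (u k) + norm (v k)"
  obtain s where s: "s > 0"
    "\<And>tp a b w t. \<lbrakk>0 < tp; 0 < t; t \<le> max_step; t \<le> 2 * tp; t \<le> s; norm a \<le> M; norm b \<le> M; norm w \<le> M\<rbrakk>
      \<Longrightarrow> \<not> linesearch_rejects H gradH \<beta> \<delta>L w (dual_trial K F gradH \<beta> tp a b w t) t"
    using short_steps_accepted[of M] by blast
  have "(\<lambda>j. step k j) \<longlonglongrightarrow> 0 * min max_step (\<tau> (k - 1) * \<alpha> k)"
    unfolding step_def using \<rho> by (intro tendsto_intros LIMSEQ_realpow_zero) auto
  then have "eventually (\<lambda>j. step k j < s) sequentially"
    using s(1) by (intro order_tendstoD(2)) auto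
  then obtain j where j: "step k j < s"
    using eventually_happens by (metis trivial_limit_sequentially)
  have "step k j \<le> 2 * \<tau> (k - 1)"
    using step_bounds(3)[OF assms, of j] mult_left_mono[OF step_bounds(4)[OF assms], of "\<tau> (k - 1)"] prev(1)
    by linarith
  then have "\<not> rejected k j"
    unfolding rejected_def trial_def
    using s(2) j prev(1) step_bounds(1,2)[OF assms, of j] by (simp add: M_def)
  then show ?thesis
    unfolding first_accepted_def by (rule LeastI)
qed

lemma \<tau>_\<theta>_bounds: "0 < \<tau> k \<and> 0 < \<theta> k \<and> \<theta> k \<le> 2"
proof (induction k)
  case 0
  then show ?case
    using \<tau>0 \<theta>_0 by simp
next
  case (Suc k)
  have k: "Suc k \<ge> 1" "\<tau> (Suc k - 1) > 0" "0 < \<theta> (Suc k - 1)" "\<theta> (Suc k - 1) \<le> 2"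
    using Suc by auto
  have \<tau>: "0 < \<tau> (Suc k)" "\<tau> (Suc k) \<le> \<tau> k * \<alpha> (Suc k)" "\<alpha> (Suc k) \<le> 2"
    using step_bounds[OF k] run_step(3)[OF k(1)] by auto
  have "\<tau> (Suc k) \<le> \<tau> k * 2"
    using \<tau>(2) Suc mult_left_mono[OF \<tau>(3), of "\<tau> k"] by linarith
  then show ?case
    using \<tau>(1) Suc run_step(5)[OF k(1)] by (simp add: pos_divide_le_eq mult.commute)
qed

lemma \<tau>_pos: "0 < \<tau> k" and \<theta>_pos: "0 < \<theta> k" and \<theta>_le: "\<theta> k \<le> 2"
  using \<tau>_\<theta>_bounds by auto

lemma linesearch_terminates: "k \<ge> 1 \<Longrightarrow> \<not> rejected k (first_accepted k)"
  by (intro linesearch_terminates_if \<tau>_pos \<theta>_pos \<theta>_le)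

lemma \<tau>_le_max_step: "k \<ge> 1 \<Longrightarrow> \<tau> k \<le> max_step"
  using step_bounds(2)[OF _ \<tau>_pos \<theta>_pos \<theta>_le] run_step(3) by simp

lemma \<theta>_power2_le:
  assumes k: "k \<ge> 1"
  shows "(\<theta> k)\<^sup>2 \<le> 1 + \<gamma> * \<theta> (k - 1)"
proof -
  have "\<theta> k \<le> \<alpha> k"
    using step_bounds(3)[OF k \<tau>_pos \<theta>_pos \<theta>_le, of "first_accepted k"]
    unfolding run_step(5)[OF k] run_step(3)[OF k, symmetric]
    by (subst pos_divide_le_eq) (simp_all add: \<tau>_pos mult.commute)
  then have "(\<theta> k)\<^sup>2 \<le> (\<alpha> k)\<^sup>2"
    using \<theta>_pos[of k] by (intro power_mono) auto
  then show ?thesis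
    using step_bounds(5)[OF k \<tau>_pos \<theta>_pos \<theta>_le] by simp
qed

lemma \<tau>_eq: "k \<ge> 1 \<Longrightarrow> \<tau> k = \<theta> k * \<tau> (k - 1)"
  using run_step(5)[of k] \<tau>_pos[of "k - 1"] by simp

section \<open>Inequalities satisfied by the iterates\<close>

definition extrapolated :: "nat \<Rightarrow> 'u" where
  "extrapolated k = u k + \<theta> k *\<^sub>R (u k - u (k - 1))"

lemma bregman_le:
  assumes "k \<ge> 1"
  shows "\<tau> k * (H (v (k + 1)) - H (v k) - gradH (v k) \<bullet> (v (k + 1) - v k))
    \<le> \<delta>L / (2 * \<beta>) * (norm (v (k + 1) - v k))\<^sup>2"
  using linesearch_terminates[OF assms] run_step(3,4)[OF assms]
  unfolding rejected_def linesearch_rejects_def by (simp add: not_less)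

lemma primal_subgradient:
  assumes "k \<ge> 1"
  shows "subgradient G (u k) ((1 / \<tau> (k - 1)) *\<^sub>R (u (k - 1) - u k) - adjoint K (v k))"
proof -
  have "subgradient G (u k) ((1 / \<tau> (k - 1)) *\<^sub>R (u (k - 1) - \<tau> (k - 1) *\<^sub>R adjoint K (v k) - u k))"
    using prox_subgradient[OF G \<tau>_pos[of "k - 1"]] run_step(1)[OF assms] by metis
  moreover have "(1 / \<tau> (k - 1)) *\<^sub>R (u (k - 1) - \<tau> (k - 1) *\<^sub>R adjoint K (v k) - u k)
      = (1 / \<tau> (k - 1)) *\<^sub>R (u (k - 1) - u k) - adjoint K (v k)"
    using \<tau>_pos[of "k - 1"] by (simp add: algebra_simps)
  ultimately show ?thesis
    by simp
qed

lemma dual_subgradient: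
  assumes "k \<ge> 1"
  shows "subgradient F (v (k + 1))
    ((1 / (\<beta> * \<tau> k)) *\<^sub>R (v k - v (k + 1)) + K (extrapolated k) - gradH (v k))"
proof -
  have pos: "\<beta> * \<tau> k > 0"
    using \<beta> \<tau>_pos by simp
  have "v (k + 1) = prox (\<beta> * \<tau> k) F (v k + (\<beta> * \<tau> k) *\<^sub>R (K (extrapolated k) - gradH (v k)))"
    using run_step(3-5)[OF assms] by (simp add: trial_def dual_trial_def Let_def extrapolated_def)
  then have "subgradient F (v (k + 1))
      ((1 / (\<beta> * \<tau> k)) *\<^sub>R (v k + (\<beta> * \<tau> k) *\<^sub>R (K (extrapolated k) - gradH (v k)) - v (k + 1)))"
    using prox_subgradient[OF F pos] by metis
  moreover have "(1 / (\<beta> * \<tau> k)) *\<^sub>R (v k + (\<beta> * \<tau> k) *\<^sub>R (K (extrapolated k) - gradH (v k)) - v (k + 1))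
      = (1 / (\<beta> * \<tau> k)) *\<^sub>R (v k - v (k + 1)) + K (extrapolated k) - gradH (v k)"
    using \<beta> \<tau>_pos[of k] by (simp add: algebra_simps)
  ultimately show ?thesis
    by simp
qed

lemma G_u_finite: "k \<ge> 1 \<Longrightarrow> G (u k) = ereal (real_of_ereal (G (u k)))"
  using primal_subgradient[of k] by (simp add: subgradient_def ereal_real)

lemma F_v_finite: "k \<ge> 2 \<Longrightarrow> F (v k) = ereal (real_of_ereal (F (v k)))"
  using dual_subgradient[of "k - 1"] by (simp add: subgradient_def ereal_real)

lemma primal_inequality:
  assumes k: "k \<ge> 1" and z: "G z = ereal b"
  shows "\<tau> (k - 1) * (real_of_ereal (G (u k)) - b)
    \<le> (u k - u (k - 1)) \<bullet> (z - u k) + \<tau> (k - 1) * (v k \<bullet> K (z - u k))"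
proof -
  define t where "t = \<tau> (k - 1)"
  have t: "t > 0"
    by (simp add: t_def \<tau>_pos)
  have "real_of_ereal (G (u k)) - b \<le> (1 / t) * ((u k - u (k - 1)) \<bullet> (z - u k)) + v k \<bullet> K (z - u k)"
    using subgradientD[OF primal_subgradient[OF k] z]
    by (simp add: inner_diff_left adjoint_clauses[OF linear_K] diff_divide_distrib t_def)
  then have "t * (real_of_ereal (G (u k)) - b)
      \<le> t * ((1 / t) * ((u k - u (k - 1)) \<bullet> (z - u k)) + v k \<bullet> K (z - u k))"
    using t by (intro mult_left_mono) auto
  then show ?thesis
    using t by (simp add: distrib_left t_def)
qed

lemma dual_inequality:
  assumes k: "k \<ge> 1" and z: "F z = ereal b"
  shows "\<tau> k * (real_of_ereal (F (v (k + 1))) - b)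
    \<le> (1 / \<beta>) * ((v (k + 1) - v k) \<bullet> (z - v (k + 1)))
      - \<tau> k * (K (extrapolated k) \<bullet> (z - v (k + 1))) + \<tau> k * (gradH (v k) \<bullet> (z - v (k + 1)))"
proof -
  define t where "t = \<tau> k"
  have t: "t > 0"
    by (simp add: t_def \<tau>_pos)
  define d where "d = z - v (k + 1)"
  have "real_of_ereal (F (v (k + 1))) - b
      \<le> (1 / (\<beta> * t)) * ((v (k + 1) - v k) \<bullet> d) - K (extrapolated k) \<bullet> d + gradH (v k) \<bullet> d"
    using subgradientD[OF dual_subgradient[OF k] z]
    by (simp add: inner_diff_left inner_add_left diff_divide_distrib t_def d_def)
  then have "t * (real_of_ereal (F (v (k + 1))) - b)
      \<le> t * ((1 / (\<beta> * t)) * ((v (k + 1) - v k) \<bullet> d) - K (extrapolated k) \<bullet> d + gradH (v k) \<bullet> d)"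
    using t by (intro mult_left_mono) auto
  also have "\<dots> = (1 / \<beta>) * ((v (k + 1) - v k) \<bullet> d) - t * (K (extrapolated k) \<bullet> d) + t * (gradH (v k) \<bullet> d)"
    using t by (simp add: distrib_left right_diff_distrib)
  finally show ?thesis
    by (simp only: t_def d_def)
qed

text \<open>With this choice, \<open>(1 - slack) * (1 - \<delta>L - slack) \<ge> 1 - \<delta>L - 2 * slack = \<delta>K\<close>: Young's
  inequality for the coupling term leaves a share \<open>slack\<close> of both quadratic terms.\<close>

definition slack :: real where
  "slack = (1 - \<delta>L - \<delta>K) / 2"

lemma slack_pos: "slack > 0" and slack_less: "slack < 1" and slack_less_\<delta>L: "slack < 1 - \<delta>L"
  using \<delta> \<delta>L \<delta>K by (auto simp: slack_def field_simps)

lemma coupling_le: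
  assumes "k \<ge> 1"
  shows "\<bar>\<tau> k * (y \<bullet> K x)\<bar>
    \<le> (1 - slack) / 2 * (norm x)\<^sup>2 + (1 - \<delta>L - slack) / (2 * \<beta>) * (norm y)\<^sup>2"
proof -
  define a b where "a = sqrt (1 - slack) * norm x" and "b = sqrt ((1 - \<delta>L - slack) / \<beta>) * norm y"
  have "\<delta>K \<le> (1 - slack) * (1 - \<delta>L - slack)"
  proof -
    have "(1 - slack) * (1 - \<delta>L - slack) = 1 - \<delta>L - 2 * slack + (slack * \<delta>L + slack\<^sup>2)"
      by (simp add: algebra_simps power2_eq_square)
    moreover have "0 \<le> slack * \<delta>L + slack\<^sup>2"
      using slack_pos \<delta>L by simp
    moreover have "1 - \<delta>L - 2 * slack = \<delta>K"
      unfolding slack_def by (simp add: field_simps)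
    ultimately show ?thesis
      by linarith
  qed
  then have "sqrt (\<delta>K / \<beta>) \<le> sqrt ((1 - slack) * ((1 - \<delta>L - slack) / \<beta>))"
    using \<beta> by (simp add: divide_right_mono)
  then have *: "sqrt (\<delta>K / \<beta>) \<le> sqrt (1 - slack) * sqrt ((1 - \<delta>L - slack) / \<beta>)"
    by (simp only: real_sqrt_mult)
  have "\<tau> k * onorm K \<le> max_step * onorm K"
    using \<tau>_le_max_step[OF assms] onorm_K_pos by (intro mult_right_mono) auto
  also have "\<dots> = sqrt (\<delta>K / \<beta>)"
    using onorm_K_pos by (simp add: max_step_def real_sqrt_divide)
  finally have \<tau>K: "\<tau> k * onorm K \<le> sqrt (1 - slack) * sqrt ((1 - \<delta>L - slack) / \<beta>)"
    using * by simp
  have "\<bar>\<tau> k * (y \<bullet> K x)\<bar> = \<tau> k * \<bar>y \<bullet> K x\<bar>"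
    using \<tau>_pos[of k] by (simp add: abs_mult)
  also have "\<dots> \<le> \<tau> k * (norm y * (onorm K * norm x))"
    using \<tau>_pos[of k] Cauchy_Schwarz_ineq2[of y "K x"] mult_left_mono[OF norm_K_le[of x] norm_ge_zero[of y]]
    by (intro mult_left_mono) auto
  also have "\<dots> = (\<tau> k * onorm K) * (norm y * norm x)"
    by simp
  also have "\<dots> \<le> (sqrt (1 - slack) * sqrt ((1 - \<delta>L - slack) / \<beta>)) * (norm y * norm x)"
    using \<tau>K by (intro mult_right_mono) auto
  also have "\<dots> = a * b"
    by (simp add: a_def b_def)
  also have "\<dots> \<le> (a\<^sup>2 + b\<^sup>2) / 2"
    using sum_squares_bound[of a b] by simp
  also have "\<dots> = (1 - slack) / 2 * (norm x)\<^sup>2 + (1 - \<delta>L - slack) / (2 * \<beta>) * (norm y)\<^sup>2"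
    using slack_less slack_less_\<delta>L \<beta> by (simp add: a_def b_def power_mult_distrib add_divide_distrib)
  finally show ?thesis .
qed

end

section \<open>Energy estimate relative to a saddle point\<close>

locale primal_dual_saddle = primal_dual_linesearch +
  fixes uh vh
  assumes saddle: "saddle_point K G F H uh vh"
begin

definition pgap :: "nat \<Rightarrow> real" where
  "pgap k = real_of_ereal (primal_gap K G uh vh (u k))"

definition dgap :: "nat \<Rightarrow> real" where
  "dgap k = real_of_ereal (dual_gap K F H uh vh (v k))"

lemma saddle_finite:
  "G uh = ereal (real_of_ereal (G uh))" "F vh = ereal (real_of_ereal (F vh))"
  using saddle saddle_point_iff[OF linear_K, of G F H uh vh] F G
    proper_lsc_convex_not_MInf[OF G, of uh] proper_lsc_convex_not_MInf[OF F, of vh]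
  by (auto simp: proper_lsc_convex_def ereal_real)

lemma saddle_gaps_nonneg: "0 \<le> primal_gap K G uh vh x" "0 \<le> dual_gap K F H uh vh y"
  using saddle saddle_point_iff[OF linear_K, of G F H uh vh] F G
  by (auto simp: proper_lsc_convex_def)

lemma pgap:
  assumes "k \<ge> 1"
  shows "primal_gap K G uh vh (u k) = ereal (pgap k)" "0 \<le> pgap k"
    "pgap k = real_of_ereal (G (u k)) - real_of_ereal (G uh) + vh \<bullet> K (u k - uh)"
proof -
  have *: "primal_gap K G uh vh (u k)
      = ereal (real_of_ereal (G (u k)) - real_of_ereal (G uh) + vh \<bullet> K (u k - uh))"
    unfolding primal_gap_def adjoint_clauses(2)[OF linear_K]
    by (subst G_u_finite[OF assms], subst saddle_finite) simp
  then show "primal_gap K G uh vh (u k) = ereal (pgap k)"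
    "pgap k = real_of_ereal (G (u k)) - real_of_ereal (G uh) + vh \<bullet> K (u k - uh)"
    by (simp_all add: pgap_def)
  then show "0 \<le> pgap k"
    using saddle_gaps_nonneg(1)[of "u k"] by simp
qed

lemma dgap:
  assumes "k \<ge> 2"
  shows "dual_gap K F H uh vh (v k) = ereal (dgap k)" "0 \<le> dgap k"
    "dgap k = real_of_ereal (F (v k)) + H (v k) - (real_of_ereal (F vh) + H vh) - K uh \<bullet> (v k - vh)"
proof -
  have *: "dual_gap K F H uh vh (v k)
      = ereal (real_of_ereal (F (v k)) + H (v k) - (real_of_ereal (F vh) + H vh) - K uh \<bullet> (v k - vh))"
    unfolding dual_gap_def
    by (subst F_v_finite[OF assms], subst saddle_finite) simp
  then show "dual_gap K F H uh vh (v k) = ereal (dgap k)"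
    "dgap k = real_of_ereal (F (v k)) + H (v k) - (real_of_ereal (F vh) + H vh) - K uh \<bullet> (v k - vh)"
    by (simp_all add: dgap_def)
  then show "0 \<le> dgap k"
    using saddle_gaps_nonneg(2)[of "v k"] by simp
qed

text \<open>Following Malitsky and Pock: test the inclusion for \<open>u (k + 1)\<close> with the saddle point, the one
  for \<open>u k\<close> with \<open>u (k + 1)\<close> and, to compensate the extrapolation, with \<open>u (k - 1)\<close>. Scaling the
  last two by \<open>\<theta> k\<close> and \<open>(\<theta> k)\<^sup>2\<close> turns their step size \<open>\<tau> (k - 1)\<close> into \<open>\<tau> k\<close>, and adding
  all up leaves a single bilinear term, which couples \<open>v (k + 1) - v k\<close> with the extrapolation
  error \<open>u (k + 1) - extrapolated k\<close>. The estimate starts at \<open>k = 2\<close> because the initial point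
  \<open>u 0\<close>, which occurs as \<open>u (k - 1)\<close> for \<open>k = 1\<close>, may lie outside the domain of \<open>G\<close>.\<close>

lemma one_step_estimate:
  assumes k: "k \<ge> 2"
  shows "\<tau> k * ((1 + \<theta> k) * pgap k - \<theta> k * pgap (k - 1) + dgap (k + 1))
    \<le> ((norm (u k - uh))\<^sup>2 - (norm (u (k + 1) - uh))\<^sup>2) / 2
      + ((norm (v k - vh))\<^sup>2 - (norm (v (k + 1) - vh))\<^sup>2) / (2 * \<beta>)
      - (norm (extrapolated k - u k))\<^sup>2 / 2
      - slack / 2 * (norm (u (k + 1) - extrapolated k))\<^sup>2
      - slack / (2 * \<beta>) * (norm (v (k + 1) - v k))\<^sup>2"
proof -
  have k1: "k \<ge> 1" "k - 1 \<ge> 1" "k + 1 \<ge> 1" "k + 1 \<ge> 2"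
    using k by auto
  note lin = linear_diff[OF linear_K] linear_add[OF linear_K] linear_scale[OF linear_K]
  define t th where "t = \<tau> k" and "th = \<theta> k"
  have t: "t = th * \<tau> (k - 1)" "th > 0" "t > 0"
    using \<tau>_eq[OF k1(1)] \<theta>_pos \<tau>_pos by (auto simp: t_def th_def)
  define u0 u1 u2 v1 v2 where "u0 = u (k - 1)" and "u1 = u k" and "u2 = u (k + 1)"
    and "v1 = v k" and "v2 = v (k + 1)"
  define g0 g1 g2 gh f2 fh where "g0 = real_of_ereal (G u0)" and "g1 = real_of_ereal (G u1)"
    and "g2 = real_of_ereal (G u2)" and "gh = real_of_ereal (G uh)"
    and "f2 = real_of_ereal (F v2)" and "fh = real_of_ereal (F vh)"
  note vars = t_def th_def u0_def u1_def u2_def v1_def v2_def g0_def g1_def g2_def gh_def f2_def fh_def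
  define y where "y = extrapolated k"
  define d where "d = th *\<^sub>R (u1 - u0)"
  have y: "y = u1 + d"
    by (simp add: y_def d_def extrapolated_def vars)
  have A: "t * (g2 - gh) \<le> (u2 - u1) \<bullet> (uh - u2) + t * (v2 \<bullet> K (uh - u2))"
    using primal_inequality[OF k1(3) saddle_finite(1)] by (simp add: vars)
  have B: "t * (g1 - g2) \<le> d \<bullet> (u2 - u1) + t * (v1 \<bullet> K (u2 - u1))"
  proof -
    have "\<tau> (k - 1) * (g1 - g2) \<le> (u1 - u0) \<bullet> (u2 - u1) + \<tau> (k - 1) * (v1 \<bullet> K (u2 - u1))"
      using primal_inequality[OF k1(1) G_u_finite[OF k1(3)]] by (simp add: vars)
    then have "th * (\<tau> (k - 1) * (g1 - g2))
        \<le> th * ((u1 - u0) \<bullet> (u2 - u1) + \<tau> (k - 1) * (v1 \<bullet> K (u2 - u1)))"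
      using t by (intro mult_left_mono) auto
    then show ?thesis
      by (simp add: t(1) d_def distrib_left mult.assoc)
  qed
  have C: "t * (th * (g1 - g0)) \<le> - (d \<bullet> d) - t * (v1 \<bullet> K d)"
  proof -
    have "\<tau> (k - 1) * (g1 - g0) \<le> (u1 - u0) \<bullet> (u0 - u1) + \<tau> (k - 1) * (v1 \<bullet> K (u0 - u1))"
      using primal_inequality[OF k1(1) G_u_finite[OF k1(2)]] by (simp add: vars)
    then have "th * th * (\<tau> (k - 1) * (g1 - g0))
        \<le> th * th * ((u1 - u0) \<bullet> (u0 - u1) + \<tau> (k - 1) * (v1 \<bullet> K (u0 - u1)))"
      using t by (intro mult_left_mono) auto
    also have "\<dots> = - (d \<bullet> d) - t * (v1 \<bullet> K d)"
      by (simp add: t(1) d_def lin algebra_simps)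
    finally show ?thesis
      by (simp add: t(1) algebra_simps)
  qed
  have D: "t * (f2 - fh) \<le> (1 / \<beta>) * ((v2 - v1) \<bullet> (vh - v2)) - t * (K y \<bullet> (vh - v2))
      + t * (gradH v1 \<bullet> (vh - v2))"
    using dual_inequality[OF k1(1) saddle_finite(2)] by (simp add: vars y_def)
  have E: "t * (gradH v1 \<bullet> (vh - v2)) \<le> t * (H vh - H v2) + \<delta>L / (2 * \<beta>) * (norm (v2 - v1))\<^sup>2"
  proof -
    have "H v1 + gradH v1 \<bullet> (vh - v1) \<le> H vh"
      using convex_GDERIV_above_tangent[OF H_convex] H_grad by blast
    then have "gradH v1 \<bullet> (vh - v2) \<le> (H vh - H v2) + (H v2 - H v1 - gradH v1 \<bullet> (v2 - v1))"
      by (simp add: inner_diff_right)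
    then have "t * (gradH v1 \<bullet> (vh - v2))
        \<le> t * ((H vh - H v2) + (H v2 - H v1 - gradH v1 \<bullet> (v2 - v1)))"
      using t by (intro mult_left_mono) auto
    moreover have "t * (H v2 - H v1 - gradH v1 \<bullet> (v2 - v1)) \<le> \<delta>L / (2 * \<beta>) * (norm (v2 - v1))\<^sup>2"
      using bregman_le[OF k1(1)] by (simp only: vars)
    ultimately show ?thesis
      unfolding distrib_left by linarith
  qed
  have I: "t * (- ((v2 - v1) \<bullet> K (u2 - y)))
      \<le> (1 - slack) / 2 * (norm (u2 - y))\<^sup>2 + (1 - \<delta>L - slack) / (2 * \<beta>) * (norm (v2 - v1))\<^sup>2"
    using coupling_le[OF k1(1), of "v2 - v1" "u2 - y"] by (simp add: t_def)
  have gaps: "t * ((1 + th) * pgap k - th * pgap (k - 1) + dgap (k + 1))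
    = t * (g2 - gh) + t * (g1 - g2) + t * (th * (g1 - g0)) + t * (f2 - fh) + t * (H v2 - H vh)
      + t * (vh \<bullet> K (y - uh)) - t * (K uh \<bullet> (v2 - vh))"
    unfolding pgap(3)[OF k1(1)] pgap(3)[OF k1(2)] dgap(3)[OF k1(4)] y d_def
    by (simp add: lin vars algebra_simps)
  have bilinear: "t * (v2 \<bullet> K (uh - u2)) + t * (v1 \<bullet> K (u2 - u1)) - t * (v1 \<bullet> K d) - t * (K y \<bullet> (vh - v2))
      + t * (vh \<bullet> K (y - uh)) - t * (K uh \<bullet> (v2 - vh)) = t * (- ((v2 - v1) \<bullet> K (u2 - y)))"
    by (simp add: y lin algebra_simps inner_commute)
  have P1: "(u2 - u1) \<bullet> (uh - u2)
      = ((norm (u1 - uh))\<^sup>2 - (norm (u2 - uh))\<^sup>2 - (norm (u2 - u1))\<^sup>2) / 2"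
    by (rule inner_three_point)
  have P2: "d \<bullet> (u2 - u1) - d \<bullet> d = ((norm (u2 - u1))\<^sup>2 - (norm (y - u1))\<^sup>2 - (norm (u2 - y))\<^sup>2) / 2"
    by (simp add: y power2_norm_eq_inner algebra_simps inner_commute)
  have P3: "(1 / \<beta>) * ((v2 - v1) \<bullet> (vh - v2))
      = ((norm (v1 - vh))\<^sup>2 - (norm (v2 - vh))\<^sup>2) / (2 * \<beta>) - 1 / (2 * \<beta>) * (norm (v2 - v1))\<^sup>2"
    unfolding inner_three_point using \<beta> by (simp add: field_simps)
  have P4: "1 / (2 * \<beta>) * (norm (v2 - v1))\<^sup>2 - \<delta>L / (2 * \<beta>) * (norm (v2 - v1))\<^sup>2
      - (1 - \<delta>L - slack) / (2 * \<beta>) * (norm (v2 - v1))\<^sup>2 = slack / (2 * \<beta>) * (norm (v2 - v1))\<^sup>2"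
    by (simp add: left_diff_distrib diff_divide_distrib)
  have P5: "(norm (u2 - y))\<^sup>2 / 2 - (1 - slack) / 2 * (norm (u2 - y))\<^sup>2 = slack / 2 * (norm (u2 - y))\<^sup>2"
    by (simp add: algebra_simps diff_divide_distrib)
  have HH: "t * (H v2 - H vh) = - (t * (H vh - H v2))"
    by (simp add: algebra_simps)
  have "t * ((1 + th) * pgap k - th * pgap (k - 1) + dgap (k + 1))
    \<le> ((norm (u1 - uh))\<^sup>2 - (norm (u2 - uh))\<^sup>2) / 2 + ((norm (v1 - vh))\<^sup>2 - (norm (v2 - vh))\<^sup>2) / (2 * \<beta>)
      - (norm (y - u1))\<^sup>2 / 2 - slack / 2 * (norm (u2 - y))\<^sup>2 - slack / (2 * \<beta>) * (norm (v2 - v1))\<^sup>2"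
    using A B C D E I gaps bilinear P1 P2 P3 P4 P5 HH
    unfolding diff_divide_distrib by linarith
  then show ?thesis
    by (simp only: vars y_def)
qed

text \<open>The gap term compensates the negative contribution of \<open>pgap (k - 1)\<close> in \<open>one_step_estimate\<close>.\<close>

definition energy :: "nat \<Rightarrow> real" where
  "energy k = (norm (u k - uh))\<^sup>2 / 2 + (norm (v k - vh))\<^sup>2 / (2 * \<beta>) + \<tau> k * \<theta> k * pgap (k - 1)"

definition decrease :: "nat \<Rightarrow> real" where
  "decrease k = (1 - \<gamma>) * (\<tau> k * \<theta> k * pgap k) + \<tau> k * dgap (k + 1)
    + (norm (extrapolated k - u k))\<^sup>2 / 2
    + slack / 2 * (norm (u (k + 1) - extrapolated k))\<^sup>2
    + slack / (2 * \<beta>) * (norm (v (k + 1) - v k))\<^sup>2"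

text \<open>The gap term of the next energy is \<open>\<tau> k * (\<theta> (k + 1))\<^sup>2 * pgap k\<close>, since
  \<open>\<tau> (k + 1) = \<theta> (k + 1) * \<tau> k\<close>; the restriction on \<open>\<theta> (k + 1)\<close> keeps it below what the
  estimate for step \<open>k\<close> provides.\<close>

lemma energy_decreases:
  assumes k: "k \<ge> 2"
  shows "energy (k + 1) + decrease k \<le> energy k"
proof -
  have "(\<theta> (k + 1))\<^sup>2 \<le> 1 + \<gamma> * \<theta> k"
    using \<theta>_power2_le[of "k + 1"] by simp
  then have "\<tau> k * (\<theta> (k + 1))\<^sup>2 * pgap k \<le> \<tau> k * (1 + \<gamma> * \<theta> k) * pgap k"
    using \<tau>_pos[of k] pgap(2)[of k] k by (intro mult_right_mono mult_left_mono) auto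
  then have "\<tau> (k + 1) * \<theta> (k + 1) * pgap k \<le> \<tau> k * (1 + \<gamma> * \<theta> k) * pgap k"
    using \<tau>_eq[of "k + 1"] by (simp add: power2_eq_square mult_ac)
  moreover have "\<tau> k * (1 + \<gamma> * \<theta> k) * pgap k
      = \<tau> k * ((1 + \<theta> k) * pgap k - \<theta> k * pgap (k - 1) + dgap (k + 1))
        + \<tau> k * \<theta> k * pgap (k - 1) - \<tau> k * dgap (k + 1) - (1 - \<gamma>) * (\<tau> k * \<theta> k * pgap k)"
    by (simp add: algebra_simps)
  ultimately show ?thesis
    using one_step_estimate[OF k] unfolding energy_def decrease_def diff_divide_distrib add_diff_cancel_right'
    by linarith
qed

lemma energy_parts_nonneg:
  assumes "k \<ge> 2"
  shows "0 \<le> \<tau> k * \<theta> k * pgap (k - 1)" "0 \<le> \<tau> k * \<theta> k * pgap k" "0 \<le> \<tau> k * dgap (k + 1)"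
proof -
  have "0 \<le> pgap (k - 1)" "0 \<le> pgap k" "0 \<le> dgap (k + 1)"
    using pgap(2)[of "k - 1"] pgap(2)[of k] dgap(2)[of "k + 1"] assms by auto
  then show "0 \<le> \<tau> k * \<theta> k * pgap (k - 1)" "0 \<le> \<tau> k * \<theta> k * pgap k" "0 \<le> \<tau> k * dgap (k + 1)"
    using \<tau>_pos[of k] \<theta>_pos[of k] by auto
qed

lemma decrease_ge:
  assumes "k \<ge> 2"
  shows "(1 - \<gamma>) * (\<tau> k * \<theta> k * pgap k) \<le> decrease k" "\<tau> k * dgap (k + 1) \<le> decrease k"
    "1 / 2 * (norm (extrapolated k - u k))\<^sup>2 \<le> decrease k"
    "slack / 2 * (norm (u (k + 1) - extrapolated k))\<^sup>2 \<le> decrease k"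
    "slack / (2 * \<beta>) * (norm (v (k + 1) - v k))\<^sup>2 \<le> decrease k"
    "0 \<le> decrease k"
proof -
  have "0 \<le> (1 - \<gamma>) * (\<tau> k * \<theta> k * pgap k)" "0 \<le> \<tau> k * dgap (k + 1)"
    using energy_parts_nonneg[OF assms] \<gamma> by auto
  moreover have "0 \<le> slack / 2 * (norm (u (k + 1) - extrapolated k))\<^sup>2"
    "0 \<le> slack / (2 * \<beta>) * (norm (v (k + 1) - v k))\<^sup>2" "0 \<le> (norm (extrapolated k - u k))\<^sup>2 / 2"
    using slack_pos \<beta> by auto
  ultimately show "(1 - \<gamma>) * (\<tau> k * \<theta> k * pgap k) \<le> decrease k" "\<tau> k * dgap (k + 1) \<le> decrease k"
    "1 / 2 * (norm (extrapolated k - u k))\<^sup>2 \<le> decrease k"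
    "slack / 2 * (norm (u (k + 1) - extrapolated k))\<^sup>2 \<le> decrease k"
    "slack / (2 * \<beta>) * (norm (v (k + 1) - v k))\<^sup>2 \<le> decrease k"
    "0 \<le> decrease k"
    unfolding decrease_def by linarith+
qed

lemma energy_ge:
  assumes "k \<ge> 2"
  shows "1 / 2 * (norm (u k - uh))\<^sup>2 \<le> energy k" "1 / (2 * \<beta>) * (norm (v k - vh))\<^sup>2 \<le> energy k"
    "0 \<le> energy k"
proof -
  have "0 \<le> (norm (v k - vh))\<^sup>2 / (2 * \<beta>)"
    using \<beta> by simp
  then show "1 / 2 * (norm (u k - uh))\<^sup>2 \<le> energy k" "1 / (2 * \<beta>) * (norm (v k - vh))\<^sup>2 \<le> energy k"
    "0 \<le> energy k"
    using energy_parts_nonneg(1)[OF assms] zero_le_power2[of "norm (u k - uh)"]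
    unfolding energy_def by simp_all
qed

lemma energy_limits:
  obtains l where "energy \<longlonglongrightarrow> l" "decrease \<longlonglongrightarrow> 0"
  using decreasing_energy_limits[of 2 energy decrease] energy_decreases energy_ge(3) decrease_ge(6)
  by blast

lemma decrease_tendsto_0: "decrease \<longlonglongrightarrow> 0"
  using energy_limits by blast

lemma iterates_bounded:
  obtains M where "\<And>k. norm (u k) \<le> M" "\<And>k. norm (v k) \<le> M"
proof -
  obtain l where "energy \<longlonglongrightarrow> l"
    using energy_limits by blast
  then have "Bseq energy"
    by (simp add: convergentI convergent_imp_Bseq)
  then obtain B where B: "\<And>k. energy k \<le> B"
    unfolding Bseq_def by (metis abs_le_D1 real_norm_def)
  have u: "norm (u k) \<le> sqrt (2 * B) + norm uh" if "k \<ge> 2" for k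
  proof -
    have "(norm (u k - uh))\<^sup>2 \<le> 2 * B"
      using energy_ge(1)[OF that] B[of k] by simp
    then have "norm (u k - uh) \<le> sqrt (2 * B)"
      by (rule real_le_rsqrt)
    then show ?thesis
      using norm_triangle_sub[of "u k" uh] by simp
  qed
  have v: "norm (v k) \<le> sqrt (2 * \<beta> * B) + norm vh" if "k \<ge> 2" for k
  proof -
    have "1 / (2 * \<beta>) * (norm (v k - vh))\<^sup>2 \<le> B"
      using energy_ge(2)[OF that] B[of k] by simp
    then have "(norm (v k - vh))\<^sup>2 \<le> 2 * \<beta> * B"
      using \<beta> by (simp add: field_simps)
    then have "norm (v k - vh) \<le> sqrt (2 * \<beta> * B)"
      by (rule real_le_rsqrt)
    then show ?thesis
      using norm_triangle_sub[of "v k" vh] by simp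
  qed
  have "Bseq (\<lambda>k. u (k + 2))" "Bseq (\<lambda>k. v (k + 2))"
    by (rule BseqI', rule u, simp) (rule BseqI', rule v, simp)
  then have "Bseq u" "Bseq v"
    using Bseq_offset by blast+
  then obtain M1 M2 where "\<And>k. norm (u k) \<le> M1" "\<And>k. norm (v k) \<le> M2"
    unfolding Bseq_def by blast
  then have "norm (u k) \<le> max M1 M2" "norm (v k) \<le> max M1 M2" for k
    by (simp_all add: le_max_iff_disj)
  then show thesis
    by (rule that)
qed

section \<open>Convergence\<close>

text \<open>If the first trial is accepted, the step is \<open>max_step\<close> or at least the previous one. Otherwise
  the trial before the accepted one was rejected, hence longer than the threshold \<open>s\<close>, and the
  accepted step is \<open>\<rho>\<close> times as long.\<close>

lemma \<tau>_lower_bound: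
  obtains t0 where "t0 > 0" "\<And>k. t0 \<le> \<tau> k"
proof -
  obtain M where M: "\<And>k. norm (u k) \<le> M" "\<And>k. norm (v k) \<le> M"
    using iterates_bounded by blast
  obtain s where s: "s > 0"
    "\<And>tp a b w t. \<lbrakk>0 < tp; 0 < t; t \<le> max_step; t \<le> 2 * tp; t \<le> s; norm a \<le> M; norm b \<le> M; norm w \<le> M\<rbrakk>
      \<Longrightarrow> \<not> linesearch_rejects H gradH \<beta> \<delta>L w (dual_trial K F gradH \<beta> tp a b w t) t"
    using short_steps_accepted[of M] by blast
  have "min (\<tau> 0) (min max_step (\<rho> * s)) \<le> \<tau> k" for k
  proof (induction k)
    case (Suc k)
    define j where "j = first_accepted (Suc k)"
    have k: "Suc k \<ge> 1"
      by simp
    note bounds = step_bounds[OF k \<tau>_pos \<theta>_pos \<theta>_le]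
    show ?case
    proof (cases j)
      case 0
      have "1 \<le> \<alpha> (Suc k)"
        using run_step(2)[OF k] by auto
      then have "\<tau> k * 1 \<le> \<tau> k * \<alpha> (Suc k)"
        using \<tau>_pos[of k] by (intro mult_left_mono) auto
      moreover have "\<tau> (Suc k) = min max_step (\<tau> k * \<alpha> (Suc k))"
        using run_step(3)[OF k] 0 by (simp add: step_def flip: j_def)
      ultimately show ?thesis
        using Suc by auto
    next
      case (Suc i)
      have "rejected (Suc k) i"
        using Suc unfolding j_def first_accepted_def by (metis lessI not_less_Least)
      moreover have "step (Suc k) i \<le> 2 * \<tau> k"
        using bounds(3)[of i] mult_left_mono[OF bounds(4), of "\<tau> k"] \<tau>_pos[of k]
        unfolding diff_Suc_1 by linarith
      ultimately have "s < step (Suc k) i"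
        using s(2)[of "\<tau> k" "step (Suc k) i" "u k" "u (Suc k)" "v (Suc k)"] bounds(1,2)[of i] \<tau>_pos[of k] M
        unfolding rejected_def trial_def by (auto simp: not_le[symmetric])
      then have "\<rho> * s \<le> \<rho> * step (Suc k) i"
        using \<rho> by auto
      also have "\<dots> = \<tau> (Suc k)"
        using run_step(3)[OF k] Suc by (simp add: step_def mult.assoc flip: j_def)
      finally show ?thesis
        by simp
    qed
  qed simp
  moreover have "min (\<tau> 0) (min max_step (\<rho> * s)) > 0"
    using \<tau>0 max_step_pos \<rho> s by simp
  ultimately show thesis
    using that by blast
qed

lemma increments_tendsto_0:
  shows "(\<lambda>k. extrapolated k - u k) \<longlonglongrightarrow> 0" "(\<lambda>k. u (k + 1) - u k) \<longlonglongrightarrow> 0" "(\<lambda>k. v (k + 1) - v k) \<longlonglongrightarrow> 0"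
proof -
  show x: "(\<lambda>k. extrapolated k - u k) \<longlonglongrightarrow> 0"
    by (rule tendsto_zero_if_power2_norm[OF tendsto_zero_if_scaled_le[OF _ decrease_tendsto_0 decrease_ge(3)]]) auto
  have "(\<lambda>k. u (k + 1) - extrapolated k) \<longlonglongrightarrow> 0"
    by (rule tendsto_zero_if_power2_norm[OF tendsto_zero_if_scaled_le[OF _ decrease_tendsto_0 decrease_ge(4)]]) (auto simp: slack_pos)
  from tendsto_add[OF this x] show "(\<lambda>k. u (k + 1) - u k) \<longlonglongrightarrow> 0"
    by simp
  show "(\<lambda>k. v (k + 1) - v k) \<longlonglongrightarrow> 0"
    by (rule tendsto_zero_if_power2_norm[OF tendsto_zero_if_scaled_le[OF _ decrease_tendsto_0 decrease_ge(5)]]) (auto simp: slack_pos \<beta>)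
qed

text \<open>The decrease controls the gaps with weights \<open>\<tau> k * \<theta> k\<close> and \<open>\<tau> k\<close>; both are bounded below
  because \<open>\<theta> k\<close> is a quotient of step sizes from a compact subinterval of the positive reals.\<close>

lemma gaps_tendsto_0: "pgap \<longlonglongrightarrow> 0" "dgap \<longlonglongrightarrow> 0"
proof -
  obtain t0 where t0: "t0 > 0" "\<And>k. t0 \<le> \<tau> k"
    using \<tau>_lower_bound by blast
  define t1 where "t1 = max (\<tau> 0) max_step"
  have t1: "\<tau> k \<le> t1" "t1 > 0" for k
    using \<tau>_le_max_step[of k] \<tau>0 by (cases "k = 0"; auto simp: t1_def)+
  have \<theta>: "t0 / t1 \<le> \<theta> k" if "k \<ge> 1" for k
    unfolding run_step(5)[OF that] using t0(2)[of k] t1(1)[of "k - 1"] \<tau>_pos[of "k - 1"] t0(1)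
    by (intro frac_le) auto
  show "pgap \<longlonglongrightarrow> 0"
  proof (rule tendsto_zero_if_scaled_le[OF _ decrease_tendsto_0])
    show "(1 - \<gamma>) * (t0 * (t0 / t1)) > 0"
      using \<gamma> t0 t1 by simp
    fix k :: nat assume k: "k \<ge> 2"
    show nn: "0 \<le> pgap k"
      using k by (intro pgap(2)) auto
    have "t0 * (t0 / t1) * pgap k \<le> \<tau> k * \<theta> k * pgap k"
      using t0 t1 \<theta>[of k] \<tau>_pos[of k] k nn by (intro mult_right_mono mult_mono) auto
    then have "(1 - \<gamma>) * (t0 * (t0 / t1) * pgap k) \<le> (1 - \<gamma>) * (\<tau> k * \<theta> k * pgap k)"
      using \<gamma> by (intro mult_left_mono) auto
    then show "(1 - \<gamma>) * (t0 * (t0 / t1)) * pgap k \<le> decrease k"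
      using decrease_ge(1)[OF k] by (simp add: mult.assoc)
  qed
  have "(\<lambda>k. dgap (k + 1)) \<longlonglongrightarrow> 0"
  proof (rule tendsto_zero_if_scaled_le[OF t0(1) decrease_tendsto_0])
    fix k :: nat assume k: "k \<ge> 2"
    show nn: "0 \<le> dgap (k + 1)"
      using k by (intro dgap(2)) auto
    show "t0 * dgap (k + 1) \<le> decrease k"
      using decrease_ge(2)[OF k] mult_right_mono[OF t0(2)[of k] nn] by linarith
  qed
  then show "dgap \<longlonglongrightarrow> 0"
    by (rule LIMSEQ_offset)
qed

lemma primal_dual_gap_tendsto_0:
  "(\<lambda>k. primal_dual_gap K G F H uh vh (u k) (v k)) \<longlonglongrightarrow> 0"
proof (rule Lim_transform_eventually)
  have "(\<lambda>k. pgap k + dgap k) \<longlonglongrightarrow> 0 + 0"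
    by (intro tendsto_add gaps_tendsto_0)
  then show "(\<lambda>k. ereal (pgap k + dgap k)) \<longlonglongrightarrow> 0"
    by (simp add: zero_ereal_def)
  show "eventually (\<lambda>k. ereal (pgap k + dgap k) = primal_dual_gap K G F H uh vh (u k) (v k)) sequentially"
    unfolding eventually_sequentially primal_dual_gap_def using pgap(1) dgap(1) by (intro exI[of _ 2]) auto
qed

text \<open>The energy converges, its gap term vanishes in the limit, and its distance terms vanish along
  \<open>r\<close>; so the limit of the energy is zero.\<close>

lemma cluster_point_is_limit:
  assumes r: "strict_mono r" and sub: "(\<lambda>n. u (r n)) \<longlonglongrightarrow> uh" "(\<lambda>n. v (r n)) \<longlonglongrightarrow> vh"
  shows "u \<longlonglongrightarrow> uh" "v \<longlonglongrightarrow> vh"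
proof -
  obtain l where l: "energy \<longlonglongrightarrow> l"
    using energy_limits by blast
  have "(\<lambda>k. \<tau> (k + 1) * \<theta> (k + 1) * pgap k) \<longlonglongrightarrow> 0"
  proof (rule real_tendsto_sandwich[of "\<lambda>_. 0" _ _ "\<lambda>k. max_step * 2 * pgap k"])
    have "0 \<le> \<tau> (k + 1) * \<theta> (k + 1) * pgap k" "\<tau> (k + 1) * \<theta> (k + 1) * pgap k \<le> max_step * 2 * pgap k"
      if "k \<ge> 1" for k
      using \<tau>_pos[of "k + 1"] \<theta>_pos[of "k + 1"] \<theta>_le[of "k + 1"] \<tau>_le_max_step[of "k + 1"] pgap(2)[OF that]
      by (auto intro!: mult_right_mono mult_mono)
    then show "eventually (\<lambda>k. 0 \<le> \<tau> (k + 1) * \<theta> (k + 1) * pgap k) sequentially"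
      "eventually (\<lambda>k. \<tau> (k + 1) * \<theta> (k + 1) * pgap k \<le> max_step * 2 * pgap k) sequentially"
      unfolding eventually_sequentially by blast+
    show "(\<lambda>k. max_step * 2 * pgap k) \<longlonglongrightarrow> 0"
      by (rule tendsto_mult_right_zero[OF gaps_tendsto_0(1)])
  qed simp
  then have "(\<lambda>k. \<tau> (k + 1) * \<theta> (k + 1) * pgap (k + 1 - 1)) \<longlonglongrightarrow> 0"
    by simp
  then have "(\<lambda>k. \<tau> k * \<theta> k * pgap (k - 1)) \<longlonglongrightarrow> 0"
    by (rule LIMSEQ_offset)
  then have p: "(\<lambda>n. \<tau> (r n) * \<theta> (r n) * pgap (r n - 1)) \<longlonglongrightarrow> 0"
    using LIMSEQ_subseq_LIMSEQ[OF _ r] by (fastforce simp: o_def)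
  have "(\<lambda>n. energy (r n)) \<longlonglongrightarrow> (norm (uh - uh))\<^sup>2 / 2 + (norm (vh - vh))\<^sup>2 / (2 * \<beta>) + 0"
    unfolding energy_def using \<beta> by (intro tendsto_intros sub p) auto
  moreover have "(\<lambda>n. energy (r n)) \<longlonglongrightarrow> l"
    using LIMSEQ_subseq_LIMSEQ[OF l r] by (simp add: o_def)
  ultimately have "l = 0"
    using LIMSEQ_unique by fastforce
  then have e: "energy \<longlonglongrightarrow> 0"
    using l by simp
  have "(\<lambda>k. u k - uh) \<longlonglongrightarrow> 0"
    by (rule tendsto_zero_if_power2_norm[OF tendsto_zero_if_scaled_le[OF _ e energy_ge(1)]]) auto
  then show "u \<longlonglongrightarrow> uh"
    by (simp add: LIM_zero_iff)
  have "(\<lambda>k. v k - vh) \<longlonglongrightarrow> 0"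
    by (rule tendsto_zero_if_power2_norm[OF tendsto_zero_if_scaled_le[OF _ e energy_ge(2)]]) (auto simp: \<beta>)
  then show "v \<longlonglongrightarrow> vh"
    by (simp add: LIM_zero_iff)
qed

text \<open>The subgradients that the algorithm produces consist of increments divided by step sizes, which
  vanish in the limit, and of continuous functions of the iterates.\<close>

lemma cluster_point_is_saddle_point:
  assumes r: "strict_mono r" and sub: "(\<lambda>n. u (r n)) \<longlonglongrightarrow> x" "(\<lambda>n. v (r n)) \<longlonglongrightarrow> y"
  shows "saddle_point K G F H x y"
proof (rule saddle_point_of_subgradients[OF linear_K G F H_convex])
  obtain t0 where t0: "t0 > 0" "\<And>k. t0 \<le> \<tau> k"
    using \<tau>_lower_bound by blast
  \<comment> \<open>The shift ensures \<open>m n \<ge> 1\<close>, where the dual inclusion is available.\<close>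
  define m where "m n = r (Suc n)" for n
  have m: "strict_mono m"
    using r by (simp add: m_def strict_mono_Suc_iff)
  have m1: "m n \<ge> 1" for n
    using seq_suble[OF r, of "Suc n"] by (simp add: m_def)
  have along: "(\<lambda>n. f (m n)) \<longlonglongrightarrow> l" if "f \<longlonglongrightarrow> l" for f :: "nat \<Rightarrow> 'z::topological_space" and l
    using LIMSEQ_subseq_LIMSEQ[OF that m] by (simp add: o_def)
  have um: "(\<lambda>n. u (m n)) \<longlonglongrightarrow> x" and vm: "(\<lambda>n. v (m n)) \<longlonglongrightarrow> y"
    using LIMSEQ_Suc[OF sub(1)] LIMSEQ_Suc[OF sub(2)] by (simp_all add: m_def)
  note du = along[OF increments_tendsto_0(2)] and dv = along[OF increments_tendsto_0(3)]
    and de = along[OF increments_tendsto_0(1)]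
  have um1: "(\<lambda>n. u (m n + 1)) \<longlonglongrightarrow> x"
    using tendsto_add[OF um du] by simp
  have vm1: "(\<lambda>n. v (m n + 1)) \<longlonglongrightarrow> y"
    using tendsto_add[OF vm dv] by simp
  have em: "(\<lambda>n. extrapolated (m n)) \<longlonglongrightarrow> x"
    using tendsto_add[OF um de] by simp
  have scaled: "(\<lambda>n. (1 / (c * \<tau> (m n))) *\<^sub>R (f (m n) - f (m n + 1))) \<longlonglongrightarrow> 0"
    if "c > 0" "(\<lambda>n. f (m n + 1) - f (m n)) \<longlonglongrightarrow> 0" for f :: "nat \<Rightarrow> 'z::real_normed_vector" and c
  proof (rule Lim_null_comparison)
    show "(\<lambda>n. 1 / (c * t0) * norm (f (m n + 1) - f (m n))) \<longlonglongrightarrow> 0"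
      by (intro tendsto_mult_right_zero tendsto_norm_zero that(2))
    have "norm ((1 / (c * \<tau> k)) *\<^sub>R (f k - f (k + 1))) \<le> 1 / (c * t0) * norm (f (k + 1) - f k)" for k
    proof -
      have "1 / (c * \<tau> k) \<le> 1 / (c * t0)"
        using t0(2)[of k] t0(1) \<open>c > 0\<close> by (intro divide_left_mono mult_left_mono mult_pos_pos \<tau>_pos) auto
      then have "1 / (c * \<tau> k) * norm (f (k + 1) - f k) \<le> 1 / (c * t0) * norm (f (k + 1) - f k)"
        by (rule mult_right_mono) simp
      then show ?thesis
        using \<tau>_pos[of k] \<open>c > 0\<close> by (simp add: norm_minus_commute)
    qed
    then show "eventually (\<lambda>n. norm ((1 / (c * \<tau> (m n))) *\<^sub>R (f (m n) - f (m n + 1)))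
        \<le> 1 / (c * t0) * norm (f (m n + 1) - f (m n))) sequentially"
      by simp
  qed
  have adj: "bounded_linear (adjoint K)"
    using adjoint_linear[OF linear_K] linear_conv_bounded_linear by blast
  show "subgradient G x (- adjoint K y)"
  proof (rule subgradient_limit[OF G _ um1])
    show "subgradient G (u (m n + 1)) ((1 / (1 * \<tau> (m n))) *\<^sub>R (u (m n) - u (m n + 1)) - adjoint K (v (m n + 1)))" for n
      using primal_subgradient[of "m n + 1"] by simp
    show "(\<lambda>n. (1 / (1 * \<tau> (m n))) *\<^sub>R (u (m n) - u (m n + 1)) - adjoint K (v (m n + 1))) \<longlonglongrightarrow> - adjoint K y"
      using tendsto_diff[OF scaled[OF zero_less_one du] bounded_linear.tendsto[OF adj vm1]] by simp
  qed
  show "subgradient F y (K x - gradH y)"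
  proof (rule subgradient_limit[OF F _ vm1])
    show "subgradient F (v (m n + 1))
        ((1 / (\<beta> * \<tau> (m n))) *\<^sub>R (v (m n) - v (m n + 1)) + K (extrapolated (m n)) - gradH (v (m n)))" for n
      by (rule dual_subgradient[OF m1])
    show "(\<lambda>n. (1 / (\<beta> * \<tau> (m n))) *\<^sub>R (v (m n) - v (m n + 1)) + K (extrapolated (m n)) - gradH (v (m n)))
        \<longlonglongrightarrow> K x - gradH y"
      using tendsto_diff[OF tendsto_add[OF scaled[OF \<beta> dv] bounded_linear.tendsto[OF bounded_linear_K em]]
          isCont_tendsto_compose[OF isCont_gradH vm]] by simp
  qed
qed (use H_grad in blast)

end

lemma (in primal_dual_linesearch) converges_to_saddle_point:
  assumes "saddle_point K G F H x0 y0"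
  obtains uh vh where "saddle_point K G F H uh vh" "(\<lambda>k. (u k, v k)) \<longlonglongrightarrow> (uh, vh)"
    "(\<lambda>k. primal_dual_gap K G F H uh vh (u k) (v k)) \<longlonglongrightarrow> 0"
proof -
  \<comment> \<open>The given saddle point serves to bound the iterates; the energy relative to a cluster point
    then shows convergence.\<close>
  interpret S0: primal_dual_saddle K G F H gradH \<beta> \<gamma> \<rho> \<delta>K \<delta>L \<alpha> \<tau> \<theta> u v x0 y0
    by unfold_locales (rule assms)
  obtain M where M: "\<And>k. norm (u k) \<le> M" "\<And>k. norm (v k) \<le> M"
    using S0.iterates_bounded by blast
  have seq: "seq_compact (cball (0::'u) M \<times> cball (0::'v) M)"
    by (intro compact_imp_seq_compact compact_Times compact_cball)
  have "\<forall>k. (u k, v k) \<in> cball (0::'u) M \<times> cball (0::'v) M"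
    using M by simp
  from seq_compactE[OF seq this] obtain z r
    where r: "strict_mono r" "((\<lambda>k. (u k, v k)) \<circ> r) \<longlonglongrightarrow> z" .
  obtain uh vh where z: "z = (uh, vh)"
    by (cases z)
  have sub: "(\<lambda>n. u (r n)) \<longlonglongrightarrow> uh" "(\<lambda>n. v (r n)) \<longlonglongrightarrow> vh"
    using tendsto_fst[OF r(2)] tendsto_snd[OF r(2)] by (simp_all add: z o_def)
  interpret S: primal_dual_saddle K G F H gradH \<beta> \<gamma> \<rho> \<delta>K \<delta>L \<alpha> \<tau> \<theta> u v uh vh
    by unfold_locales (rule S0.cluster_point_is_saddle_point[OF r(1) sub])
  show thesis
    using S.saddle tendsto_Pair[OF S.cluster_point_is_limit[OF r(1) sub]] S.primal_dual_gap_tendsto_0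
    by (rule that)
qed

theorem corollary3p8:
  fixes K :: "'u::euclidean_space \<Rightarrow> 'v::euclidean_space"
    and G :: "'u \<Rightarrow> ereal" and F :: "'v \<Rightarrow> ereal"
    and H :: "'v \<Rightarrow> real" and gradH :: "'v \<Rightarrow> 'v"
    and \<beta> \<gamma> \<rho> \<delta>K \<delta>L :: real
    and \<alpha> \<tau> \<theta> :: "nat \<Rightarrow> real"
    and u :: "nat \<Rightarrow> 'u" and v :: "nat \<Rightarrow> 'v"
  assumes "linear K" and "K \<noteq> (\<lambda>_. 0)"
    and "proper_lsc_convex F" and "proper_lsc_convex G"
    and "convex_on UNIV H"
    and "\<forall>y. GDERIV H y :> gradH y"
    and "\<forall>y. \<exists>e>0. \<exists>L. L-lipschitz_on (ball y e) gradH"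
    and "\<exists>uh vh. saddle_point K G F H uh vh"
    and "\<beta> > 0" and "\<tau> 0 > 0"
    and "\<gamma> \<in> {0<..<1}" and "\<rho> \<in> {0<..<1}"
    and "\<delta>K \<in> {0<..<1}" and "\<delta>L \<in> {0<..<1}" and "\<delta>K + \<delta>L < 1"
    and "pd_linesearch_run K G F H gradH \<beta> \<gamma> \<rho> \<delta>K \<delta>L \<alpha> \<tau> \<theta> u v"
  shows "\<exists>uh vh. saddle_point K G F H uh vh \<and>
           (\<lambda>k. (u k, v k)) \<longlonglongrightarrow> (uh, vh) \<and>
           (\<lambda>k. primal_dual_gap K G F H uh vh (u k) (v k)) \<longlonglongrightarrow> 0"
proof -
  interpret primal_dual_linesearch K G F H gradH \<beta> \<gamma> \<rho> \<delta>K \<delta>L \<alpha> \<tau> \<theta> u v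
    by (rule primal_dual_linesearch.intro) (rule assms)+
  obtain x0 y0 where "saddle_point K G F H x0 y0"
    using assms(8) by blast
  then obtain uh vh where "saddle_point K G F H uh vh" "(\<lambda>k. (u k, v k)) \<longlonglongrightarrow> (uh, vh)"
    "(\<lambda>k. primal_dual_gap K G F H uh vh (u k) (v k)) \<longlonglongrightarrow> 0"
    by (rule converges_to_saddle_point)
  then show ?thesis
    by (intro exI conjI)
qed

end
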